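(* Let $\Theta\subset\mathbb{R}^q$ be a known compact set and $\theta\in\Theta$ an uncertain constant parameter. Consider the perturbed system $\dot x=f_1(x)+\phi(\theta,x)+g_1(x)(u+d(t))$, $x\in\mathbb{R}^n$, $u\in\mathbb{R}^m$, with input perturbation $d(t)\in\mathbb{R}^m$, parameter estimator $$\dot{\hat\theta}=-\frac{\partial\beta}{\partial e}\big[f_1(x)+\phi(\mathrm{satv}(\hat\theta+\beta),x)+g_1(x)u-\dot x_r\big]-\frac{\partial\beta}{\partial x_r}\dot x_r-k_{dz}\,\mathrm{dzv}(\hat\theta+\beta)$$ and feedback $u=\psi(x_r,\dot x_r,\mathrm{satv}(\hat\theta+\beta),e)-\eta(x_r,e)$, where $e=x-x_r(t)$ and $\beta=\beta(e,x_r)=\int_0^e\varsigma(s+x_r)\,ds$, i.e. $\frac{\partial\beta}{\partial e}(e,x_r)=\varsigma(e+x_r)$. Suppose that Assumptions 1–4 stated in the context hold, and that there exists a constant $\tau_{err}>1$ such that $$\alpha_3(s)\ \ge\ \tau_{err}\;\gamma_s\Big(a^\ast\,\bar\kappa_2\big(\alpha_1^{-1}(\alpha_2(s))\big)\Big)\cdot\alpha_4(s)\cdot\kappa_1(s)$$ holds for all $s\in\mathbb{R}_+$, with $\alpha_i,\gamma_s,\kappa_1,\bar\kappa_2,a^\ast$ as in the context. Choose the nonlinear damping term as $$\eta(x_r,e)=k_d\Big[\frac{\partial V_{err}}{\partial e}\,g_1(e+x_r)\Big]^\top,\qquad k_d>0.$$ Then the closed-loop error system in the coordinates $e=x-x_r$,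 $\tilde\theta=\hat\theta-\theta+\beta(e,x_r)$, $$\dot e=F(x_r,\dot x_r,\mathrm{satv}(\theta+\tilde\theta),e)-g_1(e+x_r)\eta(x_r,e)-\tilde\phi_s(\theta,\tilde\theta,e+x_r)+g_1(e+x_r)d(t),$$ $$\dot{\tilde\theta}=H(\theta,\tilde\theta,x_r)+\Delta(\theta,\tilde\theta,x_r,e)+\varsigma(e+x_r)g_1(e+x_r)d(t),$$ is uniformly ISS with respect to the states $(e,\tilde\theta)$ and input $d(t)$.
   Context: Notation. $|\cdot|$ is the Euclidean norm (induced norm, also written $\|\cdot\|$, for matrices), $\mathbb{B}_r^k=\{x\in\mathbb{R}^k:|x|\le r\}$, $\mathbb{R}_+=[0,\infty)$. $\mathcal{SN}$: continuous nondecreasing functions $\mathbb{R}_+\to\mathbb{R}_+$. $\mathcal{K}$: strictly increasing functions in $\mathcal{SN}$ vanishing at $0$. $\mathcal{K}_\infty$: unbounded functions in $\mathcal{K}$. Uniform ISS. A system $\dot z=f(t,z,d)$ is uniformly ISS with respect to state $z$ and input $d$ if it admits a uniform ISS-Lyapunov function: a $C^1$ function $V(t,z)\ge0$ for which there are $\underline\alpha,\bar\alpha,\alpha\in\mathcal{K}_\infty$, $\sigma\in\mathcal{K}$ such that $\underline\alpha(|z|)\le V(t,z)\le\bar\alpha(|z|)$ and $V(t,z)\ge\sigma(|d|)\Rightarrow\frac{\partial V}{\partial t}+\frac{\partial V}{\partial z}f(t,z,d)\le-\alpha(|z|)$. Saturation and dead zone. $l_\theta\ge\max_{\theta\in\Theta}|\theta|$;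 saturation level $l_s>l_\theta$ (chosen as in Assumption 3), margin $0<\epsilon_s\le1$. $\mathrm{sat}(s)=s$ if $|s|\le l_s$; $\mathrm{sat}(s)=s-\mathrm{sign}(s)\frac{(|s|-l_s)^2}{2\epsilon_s}$ if $l_s\le|s|\le l_s+\epsilon_s$; $\mathrm{sat}(s)=(l_s+0.5\epsilon_s)\mathrm{sign}(s)$ if $|s|\ge l_s+\epsilon_s$. $\mathrm{dz}(s)=0$ if $|s|\le l_\theta$; $\mathrm{dz}(s)=(|s|-l_\theta)^2[2(l_\theta+1)^2-(2l_\theta+1)|s|]\,\mathrm{sign}(s)$ if $l_\theta<|s|<l_\theta+1$; $\mathrm{dz}(s)=s$ if $|s|\ge l_\theta+1$. $\mathrm{satv}$ and $\mathrm{dzv}$ apply $\mathrm{sat}$ and $\mathrm{dz}$ componentwise on $\mathbb{R}^q$. Assumption 1. $\phi(\theta,x)$ is $C^1$ in $\theta\in\mathbb{R}^q$, for all $x\in\mathbb{R}^n$. Assumption 2. The reference $x_r(t)$ is $C^1$; there is $r_1>0$ with $x_r(t)\in\mathbb{B}_{r_1}^n$ for all $t\ge0$; $x_r(t)$ and $\dot x_r(t)$ are known a priori. Assumption 3. There exist $l_s>\sqrt q\,l_\theta$ and a continuous $\varsigma:\mathbb{R}^n\to\mathbb{R}^{q\times n}$ such that $(\theta'-\theta)^\top\varsigma(x_r)[\phi(\theta',x_r)-\phi(\theta,x_r)]\ge(\theta'-\theta)^\top M_1(x_r)(\theta'-\theta)\ge0$ for all $\theta\in\Theta$ and $|\theta'|\le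 l_s$ (with $x_r=x_r(t)$ the reference), for some continuous $M_1:\mathbb{R}^n\to\mathbb{R}^{q\times q}$ satisfying $\int_t^{t+\delta}\big(M_1(x_r(\tau))+M_1^\top(x_r(\tau))\big)d\tau\ge\mu I$ for some constants $\delta,\mu>0$ and all $t\ge0$. Assumption 4. There is a function $\psi(x_r,\dot x_r,\theta,e)$ such that, with $F(x_r,\dot x_r,\theta,e)=f_1(e+x_r)+\phi(\theta,e+x_r)+g_1(e+x_r)\psi(x_r,\dot x_r,\theta,e)-\dot x_r$, the zero equilibrium of $\dot e=F(x_r,\dot x_r,\theta,e)$ is globally asymptotically stable, uniformly in $t\in\mathbb{R}_+$ and $\theta\in\mathbb{R}^q$; more specifically, there are a strict Lyapunov function $V_{err}(t,e)$ and $\alpha_1,\dots,\alpha_4\in\mathcal{K}_\infty$ such that for all $\theta\in\mathbb{R}^q$: $\alpha_1(|e|)\le V_{err}(t,e)\le\alpha_2(|e|)$, $\frac{\partial V_{err}}{\partial t}+\frac{\partial V_{err}}{\partial e}F(x_r,\dot x_r,\theta,e)\le-\alpha_3(|e|)$, $\left|\frac{\partial V_{err}}{\partial e}\right|\le\alpha_4(|e|)$. Derived objects. $\tilde\phi_s(\theta^\dag,\theta^\ddag,x)=\phi(\mathrm{satv}(\theta^\dag+\theta^\ddag),x)-\phi(\mathrm{satv}(\theta^\dag),x)$. $\gamma_s\in\mathcal{K}\setminus\mathcal{K}_\infty$ and the constant $l_\gamma>0$ satisfy $\gamma_s(s)\le l_\gamma$, $\gamma_s(s)\le s$ for all $s\ge0$,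 and $|\mathrm{satv}(\theta+\tilde\theta)-\theta|\le\gamma_s(|\tilde\theta|)$ for all $\theta\in\Theta$, $\tilde\theta\in\mathbb{R}^q$. $\kappa_1\in\mathcal{SN}$ is such that $\kappa_1(s)\ge\sup\left|\frac{\partial\phi(\theta,e+x_r)}{\partial\theta}\right|$, the supremum being over $(\theta,x_r,e)\in\mathbb{B}^q_{l_s+0.5\epsilon_s}\times\mathbb{B}_{r_1}^n\times\mathbb{B}_s^n$. With $\varphi(\theta^\dag,x_r,e^\dag)=\varsigma(x_r)\phi(\theta^\dag,x_r)-\varsigma(e^\dag)\phi(\theta^\dag,e^\dag)$, $\kappa_2\in\mathcal{K}$ is a function (whose existence the paper derives from Assumptions 1 and 2) such that $|\varphi(\theta^\dag,x_r,e+x_r)-\varphi(\theta^\ddag,x_r,e+x_r)|\le\kappa_2(|e|)|\theta^\dag-\theta^\ddag|$ for all $x_r\in\mathbb{B}_{r_1}^n$, $e\in\mathbb{R}^n$, $\theta^\dag,\theta^\ddag\in\mathbb{B}^q_{l_s+0.5\epsilon_s}$. $H(\theta,\tilde\theta,x_r)=-\varsigma(x_r)\tilde\phi_s(\theta,\tilde\theta,x_r)-k_{dz}\,\mathrm{dzv}(\tilde\theta+\theta)$ and $\Delta(\theta,\tilde\theta,x_r,e)=\varphi(\mathrm{satv}(\theta),x_r,e+x_r)-\varphi(\mathrm{satv}(\theta+\tilde\theta),x_r,e+x_r)$. $\kappa_3,\kappa_4\in\mathcal{K}$ are functions such that $|g_1(e+x_r)|\le\kappa_3(|e|)+\kappa_3^\ast$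 and $|\varsigma(e+x_r)|\le\kappa_4(|e|)+\kappa_4^\ast$ for all $e\in\mathbb{R}^n$, $x_r\in\mathbb{B}_{r_1}^n$, where $\kappa_3^\ast=\sup_{x_r\in\mathbb{B}_{r_1}^n}\|g_1(x_r)\|$, $\kappa_4^\ast=\sup_{x_r\in\mathbb{B}_{r_1}^n}\|\varsigma(x_r)\|$. $\nu(s)=[\kappa_3(s)\kappa_4(s)+\kappa_4^\ast\kappa_3(s)+\kappa_3^\ast\kappa_4(s)]^2$ and $\bar\kappa_2(s)=l_\gamma\kappa_2(s)+\nu(s)$. Choice of $k_{dz}$ and constants $a_i$. The paper derives from Assumptions 1–3 that there is $k_{dz}^\star>0$ such that for all $k_{dz}\ge k_{dz}^\star$ there are a $C^1$ function $V_{est}:\mathbb{R}_+\times\mathbb{R}^q\to\mathbb{R}_+$ and constants $a_1,\dots,a_4>0$ with $a_1|\tilde\theta|^2\le V_{est}(t,\tilde\theta)\le a_2|\tilde\theta|^2$, $\frac{\partial V_{est}}{\partial t}+\frac{\partial V_{est}}{\partial\tilde\theta}H(\theta,\tilde\theta,x_r)\le-a_3|\tilde\theta|^2$, $\left|\frac{\partial V_{est}}{\partial\tilde\theta}\right|\le a_4|\tilde\theta|$. The design gain is fixed with $k_{dz}\ge k_{dz}^\star$, the $a_i$ are these constants, and $a^\ast=\frac{\sqrt{a_2}\,a_4}{\sqrt{a_1}\,a_3}$.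
   Formalization: The bounds defining κ1 and κ2 are assumed for parameters in the box |θ_i| ≤ l_s+0.5ε_s (the range of satv), not only the Euclidean ball, and κ̄2 is assumed to be of class K∞; without these the claim fails. ISS is also shown for the actual closed loop, where Δ has the opposite sign. *)

theory Defs
  imports "HOL-Analysis.Analysis"
begin

section \<open>Comparison functions on the nonnegative reals\<close>

definition class_SN :: "(real \<Rightarrow> real) \<Rightarrow> bool" where
  "class_SN g \<longleftrightarrow> continuous_on {0..} g \<and> mono_on {0..} g \<and> (\<forall>s\<ge>0. 0 \<le> g s)"

definition class_K :: "(real \<Rightarrow> real) \<Rightarrow> bool" where
  "class_K g \<longleftrightarrow> class_SN g \<and> strict_mono_on {0..} g \<and> g 0 = 0"

definition class_Kinf :: "(real \<Rightarrow> real) \<Rightarrow> bool" where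
  "class_Kinf g \<longleftrightarrow> class_K g \<and> \<not> bounded (g ` {0..})"


section \<open>Derivatives\<close>

definition C1_on :: "('a::real_normed_vector \<Rightarrow> 'b::real_normed_vector) \<Rightarrow> 'a set \<Rightarrow> bool" where
  "C1_on f S \<longleftrightarrow> (\<exists>f' :: 'a \<Rightarrow> 'a \<Rightarrow>\<^sub>L 'b.
     (\<forall>x\<in>S. (f has_derivative blinfun_apply (f' x)) (at x within S)) \<and> continuous_on S f')"

definition grad :: "('a::real_inner \<Rightarrow> real) \<Rightarrow> 'a \<Rightarrow> 'a" where
  "grad f x = (THE D. GDERIV f x :> D)"

text \<open>Time ranges over the half-line, so at time 0 the time derivative is one-sided.\<close>

definition dtime :: "(real \<Rightarrow> 'a::real_normed_vector) \<Rightarrow> real \<Rightarrow> 'a" where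
  "dtime w t = vector_derivative w (at t within {0..})"

text \<open>\<open>dV/dt + (dV/dz) v\<close>\<close>

definition deriv_along :: "(real \<Rightarrow> 'z::real_inner \<Rightarrow> real) \<Rightarrow> real \<Rightarrow> 'z \<Rightarrow> 'z \<Rightarrow> real" where
  "deriv_along V t z v = dtime (\<lambda>s. V s z) t + grad (V t) z \<bullet> v"

text \<open>The induced Euclidean norm; the library's \<open>norm\<close> on matrices is the Frobenius norm.\<close>

definition opnorm :: "real^'c^'r \<Rightarrow> real" where
  "opnorm A = onorm ((*v) A)"

definition loewner_le :: "real^'k^'k \<Rightarrow> real^'k^'k \<Rightarrow> bool" where
  "loewner_le A B \<longleftrightarrow> (\<forall>v. v \<bullet> (A *v v) \<le> v \<bullet> (B *v v))"


section \<open>Uniform input-to-state stability\<close>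

definition uniformly_ISS ::
  "(real \<Rightarrow> 'z::euclidean_space \<Rightarrow> 'd::real_normed_vector \<Rightarrow> 'z) \<Rightarrow> bool" where
  "uniformly_ISS f \<longleftrightarrow> (\<exists>V al au \<alpha> \<sigma>.
     C1_on (\<lambda>(t, z). V t z) ({0..} \<times> UNIV) \<and>
     class_Kinf al \<and> class_Kinf au \<and> class_Kinf \<alpha> \<and> class_K \<sigma> \<and>
     (\<forall>t\<ge>0. \<forall>z. 0 \<le> V t z \<and> al (norm z) \<le> V t z \<and> V t z \<le> au (norm z)) \<and>
     (\<forall>t\<ge>0. \<forall>z d. V t z \<ge> \<sigma> (norm d) \<longrightarrow> deriv_along V t z (f t z d) \<le> - \<alpha> (norm z)))"


section \<open>Saturation and dead zone\<close>

definition sat :: "real \<Rightarrow> real \<Rightarrow> real \<Rightarrow> real" where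
  "sat ls eps s =
     (if \<bar>s\<bar> \<le> ls then s
      else if \<bar>s\<bar> \<le> ls + eps then s - sgn s * ((\<bar>s\<bar> - ls)\<^sup>2 / (2 * eps))
      else (ls + eps / 2) * sgn s)"

definition dz :: "real \<Rightarrow> real \<Rightarrow> real" where
  "dz l s =
     (if \<bar>s\<bar> \<le> l then 0
      else if \<bar>s\<bar> < l + 1
        then (\<bar>s\<bar> - l)\<^sup>2 * (2 * (l + 1)\<^sup>2 - (2 * l + 1) * \<bar>s\<bar>) * sgn s
      else s)"

definition satv :: "real \<Rightarrow> real \<Rightarrow> real^'q \<Rightarrow> real^'q" where
  "satv ls eps v = (\<chi> i. sat ls eps (v $ i))"

definition dzv :: "real \<Rightarrow> real^'q \<Rightarrow> real^'q" where
  "dzv l v = (\<chi> i. dz l (v $ i))"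

text \<open>Smallest convex set containing the range of \<open>satv\<close>. It contains the Euclidean ball of radius
  \<open>ls + eps / 2\<close>, and equals it only in dimension one: the componentwise saturation reaches the
  corners of the box, where the Euclidean norm is larger. Bounds assumed only on the ball would say
  nothing about the values the saturated estimate takes there.\<close>

definition sat_box :: "real \<Rightarrow> real \<Rightarrow> (real^'q) set" where
  "sat_box ls eps = {v. \<forall>i. \<bar>v $ i\<bar> \<le> ls + eps / 2}"


section \<open>Plant, estimator and feedback\<close>

text \<open>Line integral of \<open>vsig (s + y)\<close> from \<open>0\<close> to \<open>e\<close> along the straight segment.\<close>

definition beta :: "(real^'n \<Rightarrow> real^'n^'q) \<Rightarrow> real^'n \<Rightarrow> real^'n \<Rightarrow> real^'q" where
  "beta vsig e y = integral {0..1} (\<lambda>r. vsig (r *\<^sub>R e + y) *v e)"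

definition plant ::
  "(real^'n \<Rightarrow> real^'n) \<Rightarrow> (real^'q \<Rightarrow> real^'n \<Rightarrow> real^'n) \<Rightarrow> (real^'n \<Rightarrow> real^'m^'n) \<Rightarrow>
   real^'q \<Rightarrow> real^'n \<Rightarrow> real^'m \<Rightarrow> real^'m \<Rightarrow> real^'n" where
  "plant f1 \<phi> g1 \<theta> x u d = f1 x + \<phi> \<theta> x + g1 x *v (u + d)"

definition estimator ::
  "(real^'n \<Rightarrow> real^'n) \<Rightarrow> (real^'q \<Rightarrow> real^'n \<Rightarrow> real^'n) \<Rightarrow> (real^'n \<Rightarrow> real^'m^'n) \<Rightarrow>
   (real^'n \<Rightarrow> real^'n^'q) \<Rightarrow> real \<Rightarrow> real \<Rightarrow> real \<Rightarrow> real \<Rightarrow>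
   real^'n \<Rightarrow> real^'n \<Rightarrow> real^'n \<Rightarrow> real^'q \<Rightarrow> real^'m \<Rightarrow> real^'q" where
  "estimator f1 \<phi> g1 vsig ls eps l\<theta> kdz y y' x \<theta>h u =
     (let e = x - y; \<theta>e = \<theta>h + beta vsig e y in
       - frechet_derivative (\<lambda>e. beta vsig e y) (at e)
           (f1 x + \<phi> (satv ls eps \<theta>e) x + g1 x *v u - y')
       - frechet_derivative (\<lambda>y. beta vsig e y) (at y) y'
       - kdz *\<^sub>R dzv l\<theta> \<theta>e)"

text \<open>The nonlinear damping \<open>\<eta>\<close>. It depends on time through the reference and, as the Lyapunov
  function is time-varying, through the latter's gradient.\<close>

definition damping ::
  "(real^'n \<Rightarrow> real^'m^'n) \<Rightarrow> real \<Rightarrow> (real \<Rightarrow> real^'n \<Rightarrow> real) \<Rightarrow> real \<Rightarrow> real^'n \<Rightarrow> real^'n \<Rightarrow> real^'m" where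
  "damping g1 kd Verr t y e = kd *\<^sub>R (grad (Verr t) e v* g1 (e + y))"


section \<open>The error system\<close>

definition errF ::
  "(real^'n \<Rightarrow> real^'n) \<Rightarrow> (real^'q \<Rightarrow> real^'n \<Rightarrow> real^'n) \<Rightarrow> (real^'n \<Rightarrow> real^'m^'n) \<Rightarrow>
   (real^'n \<Rightarrow> real^'n \<Rightarrow> real^'q \<Rightarrow> real^'n \<Rightarrow> real^'m) \<Rightarrow>
   real^'n \<Rightarrow> real^'n \<Rightarrow> real^'q \<Rightarrow> real^'n \<Rightarrow> real^'n" where
  "errF f1 \<phi> g1 \<psi> y y' \<theta> e =
     f1 (e + y) + \<phi> \<theta> (e + y) + g1 (e + y) *v \<psi> y y' \<theta> e - y'"

definition phi_s ::
  "(real^'q \<Rightarrow> real^'n \<Rightarrow> real^'n) \<Rightarrow> real \<Rightarrow> real \<Rightarrow> real^'q \<Rightarrow> real^'q \<Rightarrow> real^'n \<Rightarrow> real^'n" where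
  "phi_s \<phi> ls eps \<theta> \<theta>t x = \<phi> (satv ls eps (\<theta> + \<theta>t)) x - \<phi> (satv ls eps \<theta>) x"

definition varphi ::
  "(real^'q \<Rightarrow> real^'n \<Rightarrow> real^'n) \<Rightarrow> (real^'n \<Rightarrow> real^'n^'q) \<Rightarrow> real^'q \<Rightarrow> real^'n \<Rightarrow> real^'n \<Rightarrow> real^'q" where
  "varphi \<phi> vsig \<theta> y x = vsig y *v \<phi> \<theta> y - vsig x *v \<phi> \<theta> x"

definition H_est ::
  "(real^'q \<Rightarrow> real^'n \<Rightarrow> real^'n) \<Rightarrow> (real^'n \<Rightarrow> real^'n^'q) \<Rightarrow> real \<Rightarrow> real \<Rightarrow> real \<Rightarrow> real \<Rightarrow>
   real^'q \<Rightarrow> real^'q \<Rightarrow> real^'n \<Rightarrow> real^'q" where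
  "H_est \<phi> vsig ls eps l\<theta> kdz \<theta> \<theta>t y =
     - (vsig y *v phi_s \<phi> ls eps \<theta> \<theta>t y) - kdz *\<^sub>R dzv l\<theta> (\<theta>t + \<theta>)"

definition Delta_est ::
  "(real^'q \<Rightarrow> real^'n \<Rightarrow> real^'n) \<Rightarrow> (real^'n \<Rightarrow> real^'n^'q) \<Rightarrow> real \<Rightarrow> real \<Rightarrow>
   real^'q \<Rightarrow> real^'q \<Rightarrow> real^'n \<Rightarrow> real^'n \<Rightarrow> real^'q" where
  "Delta_est \<phi> vsig ls eps \<theta> \<theta>t y e =
     varphi \<phi> vsig (satv ls eps \<theta>) y (e + y) - varphi \<phi> vsig (satv ls eps (\<theta> + \<theta>t)) y (e + y)"

definition error_system ::
  "(real^'n \<Rightarrow> real^'n) \<Rightarrow> (real^'q \<Rightarrow> real^'n \<Rightarrow> real^'n) \<Rightarrow> (real^'n \<Rightarrow> real^'m^'n) \<Rightarrow>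
   (real^'n \<Rightarrow> real^'n \<Rightarrow> real^'q \<Rightarrow> real^'n \<Rightarrow> real^'m) \<Rightarrow> (real^'n \<Rightarrow> real^'n^'q) \<Rightarrow>
   real \<Rightarrow> real \<Rightarrow> real \<Rightarrow> real \<Rightarrow> real \<Rightarrow> (real \<Rightarrow> real^'n \<Rightarrow> real) \<Rightarrow> (real \<Rightarrow> real^'n) \<Rightarrow> real^'q \<Rightarrow>
   real \<Rightarrow> (real^'n) \<times> (real^'q) \<Rightarrow> real^'m \<Rightarrow> (real^'n) \<times> (real^'q)" where
  "error_system f1 \<phi> g1 \<psi> vsig ls eps l\<theta> kdz kd Verr xr \<theta> t z d =
     (let e = fst z; \<theta>t = snd z; y = xr t; y' = dtime xr t in
       (errF f1 \<phi> g1 \<psi> y y' (satv ls eps (\<theta> + \<theta>t)) e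
          - g1 (e + y) *v damping g1 kd Verr t y e
          - phi_s \<phi> ls eps \<theta> \<theta>t (e + y) + g1 (e + y) *v d,
        H_est \<phi> vsig ls eps l\<theta> kdz \<theta> \<theta>t y + Delta_est \<phi> vsig ls eps \<theta> \<theta>t y e
          + vsig (e + y) *v (g1 (e + y) *v d)))"

text \<open>The vector field obtained from plant, estimator and feedback by the change of coordinates
  \<open>e = x - xr\<close>, \<open>\<theta>t = \<theta>h - \<theta> + beta vsig e xr\<close>. When \<open>beta\<close> has derivative
  \<open>vsig (e + y)\<close> in \<open>e\<close> and \<open>satv\<close> fixes \<open>\<theta>\<close>, it coincides with \<open>error_system\<close> except that
  \<open>Delta_est\<close> enters with the opposite sign.\<close>

definition closed_loop_error ::
  "(real^'n \<Rightarrow> real^'n) \<Rightarrow> (real^'q \<Rightarrow> real^'n \<Rightarrow> real^'n) \<Rightarrow> (real^'n \<Rightarrow> real^'m^'n) \<Rightarrow>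
   (real^'n \<Rightarrow> real^'n \<Rightarrow> real^'q \<Rightarrow> real^'n \<Rightarrow> real^'m) \<Rightarrow> (real^'n \<Rightarrow> real^'n^'q) \<Rightarrow>
   real \<Rightarrow> real \<Rightarrow> real \<Rightarrow> real \<Rightarrow> real \<Rightarrow> (real \<Rightarrow> real^'n \<Rightarrow> real) \<Rightarrow> (real \<Rightarrow> real^'n) \<Rightarrow> real^'q \<Rightarrow>
   real \<Rightarrow> (real^'n) \<times> (real^'q) \<Rightarrow> real^'m \<Rightarrow> (real^'n) \<times> (real^'q)" where
  "closed_loop_error f1 \<phi> g1 \<psi> vsig ls eps l\<theta> kdz kd Verr xr \<theta> t z d =
     (let e = fst z; \<theta>t = snd z; y = xr t; y' = dtime xr t;
          x = e + y; \<theta>h = \<theta>t + \<theta> - beta vsig e y;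
          u = \<psi> y y' (satv ls eps (\<theta>h + beta vsig e y)) e - damping g1 kd Verr t y e;
          e' = plant f1 \<phi> g1 \<theta> x u d - y';
          \<theta>h' = estimator f1 \<phi> g1 vsig ls eps l\<theta> kdz y y' x \<theta>h u
      in (e', \<theta>h' + frechet_derivative (\<lambda>e. beta vsig e y) (at e) e'
                  + frechet_derivative (\<lambda>y. beta vsig e y) (at y) y'))"


section \<open>Quantities in the small-gain condition\<close>

definition sup_opnorm :: "(real^'n \<Rightarrow> real^'c^'r) \<Rightarrow> real \<Rightarrow> real" where
  "sup_opnorm A r = (SUP y\<in>cball 0 r. opnorm (A y))"

definition nu :: "(real \<Rightarrow> real) \<Rightarrow> (real \<Rightarrow> real) \<Rightarrow> real \<Rightarrow> real \<Rightarrow> real \<Rightarrow> real" where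
  "nu \<kappa>3 \<kappa>4 c3 c4 s = (\<kappa>3 s * \<kappa>4 s + c4 * \<kappa>3 s + c3 * \<kappa>4 s)\<^sup>2"

text \<open>For class K arguments this may be bounded; the small-gain condition then says nothing about large
  errors while the parameter error is large, and the error can escape in finite time. Hence the
  condition is meant for \<open>kappa2_bar\<close> of class \<open>K\<^sub>\<infinity>\<close>, which enlarging \<open>\<kappa>2\<close> achieves.\<close>

definition kappa2_bar ::
  "real \<Rightarrow> (real \<Rightarrow> real) \<Rightarrow> (real \<Rightarrow> real) \<Rightarrow> (real \<Rightarrow> real) \<Rightarrow> real \<Rightarrow> real \<Rightarrow> real \<Rightarrow> real" where
  "kappa2_bar l\<gamma> \<kappa>2 \<kappa>3 \<kappa>4 c3 c4 s = l\<gamma> * \<kappa>2 s + nu \<kappa>3 \<kappa>4 c3 c4 s"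

end

theory Submission
  imports Defs
begin

text \<open>The error \<open>e\<close> and the parameter error \<open>p\<close> form a feedback loop whose gains are compared on the
  scales \<open>X = a * \<kappa>bar (\<alpha>1\<inverse> Verr)\<close> and \<open>y = sqrt (Vest / a1)\<close>: up to the disturbance, \<open>Vest\<close> decreases
  where \<open>y > X\<close>, and \<open>Verr\<close> decreases where \<open>\<gamma>s y \<le> \<tau>' * \<gamma>s X\<close> with \<open>1 < \<tau>' < \<tau>\<close>, hence for
  \<open>y \<le> X + m X\<close> with some \<open>m\<close> of class \<open>K\<^sub>\<infinity>\<close>. So both decrease in the overlap \<open>X < y \<le> X + m X\<close>.
  The Lyapunov function is \<open>Q Verr + P Vest\<close>, with derivatives \<open>Q' = q (X + 2/3 * m X)\<close> and \<open>P' = q y\<close>.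
  The class \<open>K\<close> function \<open>q\<close> grows so fast across each third of the overlap that below it the decrease of
  the first summand, and above it that of the second, dominates the possible increase of the other.
  Since only \<open>Q'\<close> and \<open>P'\<close> need to be continuous, no smoothing of comparison functions is required.\<close>

section \<open>Comparison functions\<close>

text \<open>The constant in \<open>X\<close> comes from the sandwich
  \<open>a1 * |p|^2 \<le> Vest \<le> a2 * |p|^2\<close>: the decay \<open>a3 * |p|\<close> is at
  least \<open>a3 * sqrt (a1 / a2) * y\<close>, and dividing the coupling
  \<open>a4 * \<kappa>bar\<close> by that rate gives \<open>a * \<kappa>bar\<close>. The obstacle is
  that each of \<open>Verr\<close> and \<open>Vest\<close> is known to decrease only on its own
  region: a plain sum fails, and the usual maximum of two rescaled functions is not C1. Hence a sum
  with state-dependent weights. The weight of \<open>Verr\<close> is taken at an interior point of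
  the overlap, so that \<open>q y\<close> is smaller than it by a prescribed factor up to the first
  third, and larger by a prescribed factor from the upper edge on. Boundedness of
  \<open>\<gamma>s\<close> enters twice: it makes \<open>m\<close> unbounded, and it bounds the
  possible growth of \<open>Verr\<close> by a function of the error alone, however large the
  parameter error is. All rates have to be functions of \<open>X\<close>, which calls for the
  inverse of \<open>\<kappa>bar\<close> on the whole half-line.\<close>

lemma class_K_D:
  assumes "class_K g"
  shows "continuous_on {0..} g" "strict_mono_on {0..} g" "g 0 = 0"
    "\<And>x. 0 \<le> x \<Longrightarrow> 0 \<le> g x"
    "\<And>x y. 0 \<le> x \<Longrightarrow> x \<le> y \<Longrightarrow> g x \<le> g y"
    "\<And>x y. 0 \<le> x \<Longrightarrow> x < y \<Longrightarrow> g x < g y"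
    "\<And>x. 0 < x \<Longrightarrow> 0 < g x"
proof -
  show 1: "continuous_on {0..} g" "strict_mono_on {0..} g" "g 0 = 0"
    and "\<And>x. 0 \<le> x \<Longrightarrow> 0 \<le> g x" and "\<And>x y. 0 \<le> x \<Longrightarrow> x \<le> y \<Longrightarrow> g x \<le> g y"
    using assms unfolding class_K_def class_SN_def by (auto simp: mono_on_def)
  show 2: "\<And>x y. 0 \<le> x \<Longrightarrow> x < y \<Longrightarrow> g x < g y"
    using 1(2) by (auto simp: strict_mono_on_def)
  show "\<And>x. 0 < x \<Longrightarrow> 0 < g x" using 2[of 0] 1(3) by simp
qed

lemma class_KI:
  assumes "continuous_on {0..} g" "g 0 = 0" "\<And>x y. 0 \<le> x \<Longrightarrow> x < y \<Longrightarrow> g x < g y"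
  shows "class_K g"
proof -
  have "g x \<le> g y" if "0 \<le> x" "x \<le> y" for x y
    using assms(3)[of x y] that by (cases "x = y") auto
  moreover from this[of 0] have "0 \<le> g x" if "0 \<le> x" for x using that assms(2) by simp
  ultimately show ?thesis
    unfolding class_K_def class_SN_def
    using assms by (auto simp: mono_on_def strict_mono_on_def)
qed

lemma class_Kinf_iff:
  "class_Kinf g \<longleftrightarrow> class_K g \<and> (\<forall>M. \<exists>s\<ge>0. M \<le> g s)"
proof -
  have "\<not> bounded (g ` {0..}) \<longleftrightarrow> (\<forall>M. \<exists>s\<ge>0. M \<le> g s)" if K: "class_K g"
  proof
    assume nb: "\<not> bounded (g ` {0..})"
    show "\<forall>M. \<exists>s\<ge>0. M \<le> g s"
    proof (rule ccontr)
      assume "\<not> ?thesis"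
      then obtain M where "\<forall>s\<ge>0. g s < M" by (metis not_le)
      then have "\<forall>x\<in>g ` {0..}. norm x \<le> M" using class_K_D(4)[OF K] by force
      then show False using nb boundedI by blast
    qed
  next
    assume *: "\<forall>M. \<exists>s\<ge>0. M \<le> g s"
    show "\<not> bounded (g ` {0..})"
    proof
      assume "bounded (g ` {0..})"
      then obtain B where "\<forall>x\<in>g ` {0..}. norm x \<le> B" by (auto simp: bounded_iff)
      then have "\<forall>s\<ge>0. g s \<le> B" by force
      with * show False by (metis add_le_same_cancel1 not_one_le_zero order_trans)
    qed
  qed
  then show ?thesis unfolding class_Kinf_def by blast
qed

lemma class_Kinf_K: "class_Kinf g \<Longrightarrow> class_K g"
  by (simp add: class_Kinf_iff)

lemmas class_Kinf_D = class_K_D[OF class_Kinf_K]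

lemma class_Kinf_unbounded: "class_Kinf g \<Longrightarrow> \<exists>s\<ge>0. M \<le> g s"
  by (simp add: class_Kinf_iff)

lemma class_K_comp:
  assumes "class_K f" "class_K g"
  shows "class_K (\<lambda>x. f (g x))"
proof (rule class_KI)
  show "continuous_on {0..} (\<lambda>x. f (g x))"
    by (rule continuous_on_compose2[OF class_K_D(1)[OF assms(1)] class_K_D(1)[OF assms(2)]])
       (auto simp: class_K_D[OF assms(2)])
qed (auto simp: class_K_D[OF assms(1)] class_K_D[OF assms(2)])

lemma class_Kinf_comp:
  assumes f: "class_Kinf f" and g: "class_Kinf g"
  shows "class_Kinf (\<lambda>x. f (g x))"
  unfolding class_Kinf_iff
proof (intro conjI allI)
  show "class_K (\<lambda>x. f (g x))" by (rule class_K_comp[OF class_Kinf_K[OF f] class_Kinf_K[OF g]])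
  fix M
  obtain s where "s \<ge> 0" "M \<le> f s" using class_Kinf_unbounded[OF f] by blast
  moreover obtain t where "t \<ge> 0" "s \<le> g t" using class_Kinf_unbounded[OF g] by blast
  ultimately show "\<exists>t\<ge>0. M \<le> f (g t)" using class_Kinf_D(5)[OF f] order_trans by blast
qed

lemma class_K_add:
  assumes "class_K f" "class_K g"
  shows "class_K (\<lambda>x. f x + g x)"
  using assms by (intro class_KI continuous_on_add) (auto simp: class_K_D add_strict_mono)

lemma class_Kinf_add:
  assumes f: "class_Kinf f" and g: "class_K g"
  shows "class_Kinf (\<lambda>x. f x + g x)"
  unfolding class_Kinf_iff
proof (intro conjI allI)
  show "class_K (\<lambda>x. f x + g x)" using class_Kinf_K[OF f] g by (rule class_K_add)
  fix M
  obtain s where "s \<ge> 0" "M \<le> f s" using class_Kinf_unbounded[OF f] by blast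
  then show "\<exists>s\<ge>0. M \<le> f s + g s" using class_K_D(4)[OF g, of s] by (intro exI[of _ s]) auto
qed

lemma class_K_scale: "class_K f \<Longrightarrow> 0 < c \<Longrightarrow> class_K (\<lambda>x. c * f x)"
  by (intro class_KI continuous_intros) (auto simp: class_K_D)

lemma class_Kinf_id: "class_Kinf (\<lambda>x. x)"
  unfolding class_Kinf_iff
proof (intro conjI allI)
  show "class_K (\<lambda>x::real. x)" by (intro class_KI) auto
  show "\<exists>s\<ge>0. M \<le> s" for M :: real by (intro exI[of _ "max 0 M"]) auto
qed

lemma class_Kinf_scale:
  assumes f: "class_Kinf f" and c: "0 < c"
  shows "class_Kinf (\<lambda>x. c * f x)"
  unfolding class_Kinf_iff
proof (intro conjI allI)
  show "class_K (\<lambda>x. c * f x)" using assms by (intro class_K_scale class_Kinf_K)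
  fix M
  obtain s where "s \<ge> 0" "M / c \<le> f s" using class_Kinf_unbounded[OF f] by blast
  then show "\<exists>s\<ge>0. M \<le> c * f s" using c by (intro exI[of _ s]) (auto simp: field_simps)
qed

lemma class_Kinf_min:
  assumes f: "class_Kinf f" and g: "class_Kinf g"
  shows "class_Kinf (\<lambda>x. min (f x) (g x))"
  unfolding class_Kinf_iff
proof (intro conjI allI)
  show "class_K (\<lambda>x. min (f x) (g x))"
    by (intro class_KI continuous_on_min class_Kinf_D(1)[OF f] class_Kinf_D(1)[OF g])
       (auto simp: min_less_iff_disj class_Kinf_D(3,6)[OF f] class_Kinf_D(3,6)[OF g])
  fix M
  obtain s where s: "s \<ge> 0" "M \<le> f s" using class_Kinf_unbounded[OF f] by blast
  obtain t where t: "t \<ge> 0" "M \<le> g t" using class_Kinf_unbounded[OF g] by blast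
  have "f s \<le> f (max s t)" "g t \<le> g (max s t)"
    using s t by (auto intro!: class_Kinf_D(5)[OF f] class_Kinf_D(5)[OF g])
  with s t show "\<exists>s\<ge>0. M \<le> min (f s) (g s)" by (intro exI[of _ "max s t"]) auto
qed

lemma class_Kinf_mult:
  assumes f: "class_Kinf f" and g: "class_K g"
  shows "class_Kinf (\<lambda>x. g x * f x)"
  unfolding class_Kinf_iff
proof (intro conjI allI)
  show "class_K (\<lambda>x. g x * f x)"
    by (intro class_KI continuous_on_mult class_Kinf_D(1)[OF f] class_K_D(1)[OF g])
       (auto intro!: mult_strict_mono' class_Kinf_D(4,6)[OF f] class_K_D(4,6)[OF g]
         simp: class_K_D(3)[OF g])
  fix M
  have g1: "0 < g 1" using class_K_D(7)[OF g] by simp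
  obtain s where s: "s \<ge> 0" "\<bar>M\<bar> / g 1 \<le> f s" using class_Kinf_unbounded[OF f] by blast
  have "M \<le> g 1 * f s" using s g1 by (auto simp: field_simps)
  also have "\<dots> \<le> g (max 1 s) * f (max 1 s)"
    using s by (intro mult_mono class_Kinf_D(4,5)[OF f] class_K_D(4,5)[OF g]) auto
  finally show "\<exists>s\<ge>0. M \<le> g s * f s" using s by (intro exI[of _ "max 1 s"]) auto
qed

lemma class_Kinf_square: "class_Kinf (\<lambda>x. x\<^sup>2)"
  using class_Kinf_mult[OF class_Kinf_id class_Kinf_K[OF class_Kinf_id]] by (simp add: power2_eq_square)

lemma class_Kinf_sqrt: "class_Kinf sqrt"
  unfolding class_Kinf_iff
proof (intro conjI allI)
  show "class_K sqrt" by (intro class_KI continuous_intros) auto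
  show "\<exists>s\<ge>0. M \<le> sqrt s" for M by (intro exI[of _ "M\<^sup>2"]) auto
qed

lemma class_Kinf_bij:
  assumes g: "class_Kinf g"
  shows "bij_betw g {0..} {0..}"
proof (rule bij_betw_imageI)
  show "inj_on g {0..}" using class_Kinf_D(2)[OF g] strict_mono_on_imp_inj_on by blast
  show "g ` {0..} = {0..}"
  proof
    show "g ` {0..} \<subseteq> {0..}" using class_Kinf_D(4)[OF g] by auto
    show "{0..} \<subseteq> g ` {0..}"
    proof
      fix y :: real assume y: "y \<in> {0..}"
      obtain s where s: "s \<ge> 0" "y \<le> g s" using class_Kinf_unbounded[OF g] by blast
      have "continuous_on {0..s} g" by (rule continuous_on_subset[OF class_Kinf_D(1)[OF g]]) auto
      then show "y \<in> g ` {0..}"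
        using IVT'[of g 0 y s] s y class_Kinf_D(3)[OF g] by auto
    qed
  qed
qed

lemma class_Kinf_inv:
  assumes g: "class_Kinf g"
  shows "\<And>x. 0 \<le> x \<Longrightarrow> g (inv_into {0..} g x) = x"
    and "\<And>x. 0 \<le> x \<Longrightarrow> inv_into {0..} g (g x) = x"
    and "class_Kinf (inv_into {0..} g)"
proof -
  let ?h = "inv_into {0..} g"
  note b = class_Kinf_bij[OF g]
  show gh: "\<And>x. 0 \<le> x \<Longrightarrow> g (?h x) = x"
    using b by (metis atLeast_iff bij_betw_inv_into_right)
  show hg: "\<And>x. 0 \<le> x \<Longrightarrow> ?h (g x) = x"
    using b by (metis atLeast_iff bij_betw_inv_into_left)
  have h0: "\<And>x. 0 \<le> x \<Longrightarrow> 0 \<le> ?h x"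
    using b by (metis atLeast_iff bij_betw_def inv_into_into)
  have hm: "?h x < ?h y" if "0 \<le> x" "x < y" for x y
  proof (rule ccontr)
    assume "\<not> ?thesis"
    then have "g (?h y) \<le> g (?h x)" using h0 that by (intro class_Kinf_D(5)[OF g]) auto
    then show False using gh that by auto
  qed
  \<comment> \<open>Extended by the identity to negative arguments, the inverse becomes a monotone
    surjection of the real line, and such a map is continuous.\<close>
  define H where "H = (\<lambda>x. if 0 \<le> x then ?h x else x)"
  have "range H = UNIV"
  proof -
    have "H (if 0 \<le> x then g x else x) = x" for x
      using hg[of x] class_Kinf_D(4)[OF g, of x] by (simp add: H_def)
    then show ?thesis by (rule surjI)
  qed
  moreover have "H x \<le> H y" if "x \<le> y" for x y
    using that hm[of x y] h0[of y] by (cases "x = y") (auto simp: H_def)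
  ultimately have "continuous_on UNIV H" by (intro continuous_onI_mono) auto
  then have "continuous_on {0..} H" using continuous_on_subset by blast
  then have ch: "continuous_on {0..} ?h" by (rule continuous_on_eq) (auto simp: H_def)
  show "class_Kinf ?h"
    unfolding class_Kinf_iff
  proof (intro conjI allI)
    show "class_K ?h" using ch hm hg[of 0] class_Kinf_D(3)[OF g] by (intro class_KI) auto
    show "\<exists>s\<ge>0. M \<le> ?h s" for M
      using hg[of "max 0 M"] class_Kinf_D(4)[OF g, of "max 0 M"]
      by (intro exI[of _ "g (max 0 M)"]) auto
  qed
qed

section \<open>Continuous envelopes by infimal convolution, and a rapidly growing weight\<close>

text \<open>Each member of the family is 1-Lipschitz in \<open>s\<close>, and so is their infimum.
  No regularity of \<open>g\<close> enters, so irregular data can be replaced by continuous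
  ones.\<close>

lemma inf_convolution_lipschitz:
  fixes g :: "'i \<Rightarrow> real" and p :: "'i \<Rightarrow> real \<Rightarrow> real"
  assumes "I \<noteq> {}" "\<And>i. i \<in> I \<Longrightarrow> 0 \<le> g i" "\<And>i s. i \<in> I \<Longrightarrow> 0 \<le> p i s"
    and "\<And>i s s'. i \<in> I \<Longrightarrow> \<bar>p i s - p i s'\<bar> \<le> \<bar>s - s'\<bar>"
  shows "continuous_on UNIV (\<lambda>s. INF i\<in>I. g i + p i s)"
proof -
  have bdd: "bdd_below ((\<lambda>i. g i + p i s) ` I)" for s
    using assms(2,3) by (intro bdd_belowI2[of _ 0]) (simp add: add_nonneg_nonneg)
  have le: "(INF i\<in>I. g i + p i s) \<le> (INF i\<in>I. g i + p i s') + \<bar>s - s'\<bar>" for s s'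
  proof -
    have "(INF i\<in>I. g i + p i s) - \<bar>s - s'\<bar> \<le> (INF i\<in>I. g i + p i s')"
    proof (rule cINF_greatest[OF assms(1)])
      fix i assume i: "i \<in> I"
      have "(INF i\<in>I. g i + p i s) \<le> g i + p i s" by (rule cINF_lower[OF bdd i])
      then show "(INF i\<in>I. g i + p i s) - \<bar>s - s'\<bar> \<le> g i + p i s'"
        using assms(4)[OF i, of s s'] by linarith
    qed
    then show ?thesis by simp
  qed
  have "1-lipschitz_on UNIV (\<lambda>s. INF i\<in>I. g i + p i s)"
  proof (rule lipschitz_onI)
    fix s s' :: real
    show "dist (INF i\<in>I. g i + p i s) (INF i\<in>I. g i + p i s') \<le> 1 * dist s s'"
      using le[of s s'] le[of s' s] by (simp add: dist_real_def abs_le_iff abs_minus_commute)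
  qed simp
  then show ?thesis by (rule lipschitz_on_continuous_on)
qed

text \<open>The largest admissible \<open>c\<close> may jump with \<open>t\<close>. Being bounded
  away from zero on every half-line \<open>t \<ge> s\<close> and eventually exceeding any bound both
  survive a monotone regularisation from below.\<close>

lemma class_Kinf_minorant:
  fixes P :: "real \<Rightarrow> real \<Rightarrow> bool"
  assumes down: "\<And>t c c'. P t c \<Longrightarrow> 0 \<le> c' \<Longrightarrow> c' \<le> c \<Longrightarrow> P t c'"
    and pos: "\<And>s. 0 < s \<Longrightarrow> \<exists>c>0. \<forall>t\<ge>s. P t c"
    and unb: "\<And>M. \<exists>s>0. \<forall>t\<ge>s. P t M"
  shows "\<exists>m. class_Kinf m \<and> (\<forall>t>0. P t (m t)) \<and> (\<forall>t\<ge>0. m t \<le> t)"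
proof -
  \<comment> \<open>The cap \<open>c \<le> t\<close> makes the supremum finite and later yields
    \<open>m t \<le> t\<close>. The alternative \<open>c = 0\<close> keeps the set nonempty at
    \<open>t = 0\<close>, where nothing is known about \<open>P\<close>.\<close>
  define g where "g = (\<lambda>t. Sup {c. 0 \<le> c \<and> c \<le> t \<and> (c = 0 \<or> P t c)})"
  have bdd: "bdd_above {c. 0 \<le> c \<and> c \<le> t \<and> (c = 0 \<or> P t c)}" for t by (rule bdd_aboveI[of _ t]) auto
  have upper: "c \<le> g t" if "0 \<le> c" "c \<le> t" "c = 0 \<or> P t c" for c t
    unfolding g_def using that by (intro cSup_upper[OF _ bdd]) auto
  have g0: "0 \<le> g t" if "0 \<le> t" for t using upper[of 0 t] that by simp
  have gt: "g t \<le> t" if "0 \<le> t" for t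
    unfolding g_def using that by (intro cSup_least) auto
  have below: "P t c" if tc: "0 < c" "c < g t" "0 \<le> t" for t c
  proof -
    have "{c. 0 \<le> c \<and> c \<le> t \<and> (c = 0 \<or> P t c)} \<noteq> {}" using that by auto
    then obtain c' where "c' \<in> {c. 0 \<le> c \<and> c \<le> t \<and> (c = 0 \<or> P t c)}" "c < c'"
      using tc(2) less_cSup_iff[OF _ bdd, of t c] unfolding g_def by blast
    then show ?thesis using down[of t c' c] that by auto
  qed
  \<comment> \<open>A one-sided penalty: it is nondecreasing in \<open>s\<close>, which makes
    \<open>h\<close> nondecreasing, and it vanishes at \<open>r = s\<close>, which puts
    \<open>h\<close> below \<open>g\<close>.\<close>
  define p where "p = (\<lambda>r s :: real. max 0 (s - r))"
  define h where "h = (\<lambda>s. INF r\<in>{0..}. g r + p r s)"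
  have cont: "continuous_on UNIV h"
    unfolding h_def by (rule inf_convolution_lipschitz) (auto simp: g0 p_def)
  have bddh: "bdd_below ((\<lambda>r. g r + p r s) ` {0..})" for s
    by (intro bdd_belowI2[of _ 0]) (auto simp: g0 p_def)
  have hg: "h s \<le> g s" if "0 \<le> s" for s
    using cINF_lower[OF bddh, of s s] that by (simp add: h_def p_def)
  have hmono: "h s \<le> h s'" if "s \<le> s'" for s s'
    unfolding h_def
  proof (rule cINF_mono[OF _ bddh])
    fix r :: real assume "r \<in> {0..}"
    then show "\<exists>n\<in>{0..}. g n + p n s \<le> g r + p r s'"
      using that by (intro bexI[of _ r]) (auto simp: p_def)
  qed simp
  have hlow: "min c (s / 2) \<le> h s" if "0 < s" "\<forall>t\<ge>s/2. P t c" "0 \<le> c" for s c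
    unfolding h_def
  proof (rule cINF_greatest)
    fix r :: real assume r: "r \<in> {0..}"
    show "min c (s / 2) \<le> g r + p r s"
    proof (cases "r \<le> s / 2")
      case True
      then show ?thesis using g0[of r] r by (auto simp: p_def)
    next
      case False
      then have "min c (s/2) \<le> g r"
        using that down[of r c "min c (s/2)"] by (intro upper) (auto simp: min_def)
      then show ?thesis by (simp add: p_def)
    qed
  qed simp
  have hpos: "0 < h s" if s: "0 < s" for s
  proof -
    obtain c where "c > 0" "\<forall>t\<ge>s/2. P t c" using pos[of "s/2"] s by auto
    then have "min c (s/2) \<le> h s" using hlow[of s c] s by simp
    then show ?thesis using \<open>c > 0\<close> s by linarith
  qed
  have hunb: "\<exists>s\<ge>0. M \<le> h s" for M
  proof -
    obtain s where s: "s > 0" "\<forall>t\<ge>s. P t \<bar>M\<bar>" using unb by blast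
    define s' where "s' = max (2 * s) (2 * \<bar>M\<bar>)"
    have "min \<bar>M\<bar> (s'/2) \<le> h s'" using s by (intro hlow) (auto simp: s'_def)
    moreover have "\<bar>M\<bar> \<le> s' / 2" "0 \<le> s'" using s by (auto simp: s'_def)
    ultimately show ?thesis by (intro exI[of _ s']) auto
  qed
  \<comment> \<open>The factor \<open>s / (1 + s)\<close> makes the function strictly increasing and
    puts it strictly below the supremum \<open>g\<close>, which need not be attained. It is at least
    1/2 from 1 on, so unboundedness is kept.\<close>
  define m where "m = (\<lambda>s. s / (1 + s) * h s)"
  have frac: "x / (1 + x) < y / (1 + y)" if "0 \<le> x" "x < y" for x y :: real
    using that by (simp add: divide_simps) argo
  have mlt: "m s < h s" if "0 < s" for s
    using that hpos[OF that] by (simp add: m_def field_simps)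
  show ?thesis
  proof (intro exI[of _ m] conjI allI impI)
    show "class_Kinf m"
      unfolding class_Kinf_iff
    proof (intro conjI allI)
      show "class_K m"
      proof (rule class_KI)
        show "continuous_on {0..} m" unfolding m_def
          by (intro continuous_intros continuous_on_subset[OF cont]) auto
        show "m 0 = 0" by (simp add: m_def)
        fix x y :: real assume xy: "0 \<le> x" "x < y"
        have "m x \<le> x / (1 + x) * h y"
          unfolding m_def using xy hmono[of x y] by (intro mult_left_mono) auto
        also have "\<dots> < m y"
          unfolding m_def using frac[OF xy] hpos[of y] xy by (intro mult_strict_right_mono) auto
        finally show "m x < m y" .
      qed
      fix M :: real
      obtain s where s: "s \<ge> 0" "2 * \<bar>M\<bar> \<le> h s" using hunb by blast
      define s' where "s' = max 1 s"
      have s': "1 \<le> s'" by (simp add: s'_def)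
      have "\<bar>M\<bar> \<le> h s / 2" using s by simp
      also have "\<dots> \<le> h s' / 2" using hmono[of s s'] by (simp add: s'_def)
      also have "\<dots> \<le> s' / (1 + s') * h s'"
        using s' hpos[of s'] mult_right_mono[of "1/2" "s' / (1 + s')" "h s'"]
        by (simp add: field_simps)
      finally show "\<exists>s\<ge>0. M \<le> m s" using s' by (intro exI[of _ s']) (auto simp: m_def)
    qed
    fix t :: real
    { assume t: "0 < t"
      have "0 < m t" using t hpos[OF t] by (auto simp: m_def)
      then show "P t (m t)" using below[of "m t" t] mlt[OF t] hg[of t] t by linarith }
    { assume t: "0 \<le> t"
      then show "m t \<le> t" using mlt[of t] hg[of t] gt[of t]
        by (cases "t = 0") (auto simp: m_def) }
  qed
qed

text \<open>A demand made at \<open>x\<close> has to hold throughout \<open>[x, 2 * x]\<close>, so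
  \<open>k s\<close> must dominate \<open>f\<close> on all of \<open>[s / 2, s]\<close>. Passing to
  reciprocals turns this moving supremum into an infimum, which can be regularised by a
  penalty.\<close>

lemma continuous_majorant_doubling:
  fixes f :: "real \<Rightarrow> real"
  assumes f: "continuous_on {0<..} f"
  shows "\<exists>k. continuous_on {0<..} k \<and> (\<forall>s>0. 0 < k s) \<and>
    (\<forall>x s. 0 < x \<longrightarrow> x \<le> s \<longrightarrow> s \<le> 2 * x \<longrightarrow> f x \<le> k s)"
proof -
  define g where "g = (\<lambda>x. 1 / max 1 (f x))"
  \<comment> \<open>Zero exactly when \<open>x \<le> s \<le> 2 * x\<close>, and of slope at most 1
    in \<open>s\<close>.\<close>
  define p where "p = (\<lambda>x s :: real. max 0 (max (x - s) (s - 2 * x)))"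
  define q where "q = (\<lambda>s. INF x\<in>{0<..}. g x + p x s)"
  have g0: "0 \<le> g x" and p0: "0 \<le> p x s" for x s by (auto simp: g_def p_def)
  have cont: "continuous_on UNIV q"
    unfolding q_def by (rule inf_convolution_lipschitz) (auto simp: g0 p0 p_def)
  have bdd: "bdd_below ((\<lambda>x. g x + p x s) ` {0<..})" for s
    by (intro bdd_belowI2[of _ 0]) (simp add: g0 p0)
  have qpos: "0 < q s" if s: "0 < s" for s
  proof -
    have "compact (f ` {s/4..2 * s})"
      using s by (intro compact_continuous_image continuous_on_subset[OF f]) auto
    then obtain B where B: "\<And>x. x \<in> {s/4..2 * s} \<Longrightarrow> \<bar>f x\<bar> \<le> B"
      by (fastforce dest!: compact_imp_bounded simp: bounded_iff)
    have "min (1 / max 1 B) (s/2) \<le> q s"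
      unfolding q_def
    proof (rule cINF_greatest)
      fix x :: real assume x: "x \<in> {0<..}"
      \<comment> \<open>On the two outer ranges the penalty alone is at least \<open>s / 2\<close>;
        on the compact middle range \<open>f\<close> is bounded.\<close>
      consider "x < s/4" | "x \<in> {s/4..2 * s}" | "2 * s < x" by fastforce
      then show "min (1 / max 1 B) (s/2) \<le> g x + p x s"
      proof cases
        case 1
        then show ?thesis using g0[of x] s by (auto simp: p_def min_def max_def)
      next
        case 2
        have "1 / max 1 B \<le> g x"
          unfolding g_def using B[OF 2] by (intro divide_left_mono) auto
        then show ?thesis using p0[of x s] by linarith
      next
        case 3
        then show ?thesis using g0[of x] s by (auto simp: p_def min_def max_def)
      qed
    qed simp
    moreover have "0 < min (1 / max 1 B) (s/2)" using s by (simp add: less_max_iff_disj)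
    ultimately show ?thesis by linarith
  qed
  show ?thesis
  proof (intro exI[of _ "\<lambda>s. 1 / q s"] conjI allI impI)
    show "continuous_on {0<..} (\<lambda>s. 1 / q s)"
      using qpos by (intro continuous_intros continuous_on_subset[OF cont]) force+
    show "0 < 1 / q s" if "0 < s" for s using qpos[OF that] by simp
    show "f x \<le> 1 / q s" if "0 < x" "x \<le> s" "s \<le> 2 * x" for x s
    proof -
      have "q s \<le> g x + p x s" unfolding q_def by (rule cINF_lower[OF bdd]) (use that in auto)
      then have "q s \<le> 1 / max 1 (f x)" using that by (simp add: p_def g_def)
      then have "max 1 (f x) \<le> 1 / q s"
        using qpos[of s] that le_divide_eq[of "q s" 1 "max 1 (f x)"] pos_le_divide_eq[of "q s" "max 1 (f x)" 1]
        by (simp only: mult.commute)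
      then show ?thesis by linarith
    qed
  qed
qed

text \<open>For \<open>q x = x * exp (K x)\<close> with \<open>K' = k\<close> the logarithmic
  derivative is at least \<open>k\<close>, which on \<open>[X, 2 * X]\<close> is at least
  \<open>f X\<close>; integrating gives the exponential factor.\<close>

lemma class_K_rapid_growth:
  fixes f :: "real \<Rightarrow> real"
  assumes f: "continuous_on {0<..} f"
  shows "\<exists>q. class_K q \<and>
    (\<forall>X x y. 0 < X \<longrightarrow> X \<le> x \<longrightarrow> x < y \<longrightarrow> y \<le> 2 * X \<longrightarrow> exp (f X * (y - x)) * q x \<le> q y)"
proof -
  obtain k where k: "continuous_on {0<..} k" "\<And>s. 0 < s \<Longrightarrow> 0 < k s"
    "\<And>x s. 0 < x \<Longrightarrow> x \<le> s \<Longrightarrow> s \<le> 2 * x \<Longrightarrow> f x \<le> k s"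
    using continuous_majorant_doubling[OF f] by blast
  have "isCont k x" if "0 < x" for x
    using k(1) that by (simp add: continuous_on_eq_continuous_at)
  then have "\<exists>F. \<forall>x :: real. 0 < ereal x \<longrightarrow> ereal x < \<infinity> \<longrightarrow> (F has_vector_derivative k x) (at x)"
    by (intro einterval_antiderivative) auto
  then obtain K where K: "\<And>x. 0 < x \<Longrightarrow> (K has_real_derivative k x) (at x)"
    by (auto simp: has_real_derivative_iff_has_vector_derivative)
  have Kmvt: "\<exists>z. x < z \<and> z < y \<and> K y - K x = (y - x) * k z" if "0 < x" "x < y" for x y
    using MVT2[of x y K k] that K by auto
  have Kmono: "K x < K y" if xy: "0 < x" "x < y" for x y
  proof -
    obtain z where "x < z" "K y - K x = (y - x) * k z" using Kmvt[of x y] xy by blast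
    moreover have "0 < (y - x) * k z" using \<open>x < z\<close> xy k(2)[of z] by simp
    ultimately show ?thesis by linarith
  qed
  \<comment> \<open>\<open>K\<close> may have a finite limit at 0, so the exponential alone need not
    vanish there; the factor \<open>x\<close> forces the value 0, and monotonicity of
    \<open>K\<close> keeps the exponential bounded near 0.\<close>
  define q where "q = (\<lambda>x. if x \<le> 0 then 0 else x * exp (K x))"
  have q_pos: "q x = x * exp (K x)" if "0 < x" for x using that by (simp add: q_def)
  have "class_K q"
  proof (rule class_KI)
    show "q 0 = 0" by (simp add: q_def)
    show "q x < q y" if "0 \<le> x" "x < y" for x y
    proof (cases "x = 0")
      case False
      then show ?thesis
        using that Kmono[of x y] by (auto simp: q_def intro!: mult_strict_mono)
    qed (use that in \<open>simp add: q_def\<close>)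
    show "continuous_on {0..} q"
      unfolding continuous_on_eq_continuous_within
    proof
      fix x :: real assume x: "x \<in> {0..}"
      show "continuous (at x within {0..}) q"
      proof (cases "x = 0")
        case True
        have "(q \<longlongrightarrow> 0) (at 0 within {0..})"
        proof (rule Lim_null_comparison)
          have "\<forall>\<^sub>F y in at 0 within {0..}. y \<in> {0..} \<and> dist y 0 < 1"
            by (auto simp: eventually_at intro!: exI[of _ 1])
          then show "\<forall>\<^sub>F y in at 0 within {0..}. norm (q y) \<le> y * exp (K 1)"
          proof eventually_elim
            case (elim y)
            then show ?case using Kmono[of y 1] by (auto simp: q_def)
          qed
          show "((\<lambda>y. y * exp (K 1)) \<longlongrightarrow> 0) (at 0 within {0..})"
            by (auto intro!: tendsto_eq_intros)
        qed
        then show ?thesis using True by (simp add: continuous_within q_def)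
      next
        case False
        then have "0 < x" using x by simp
        have "isCont (\<lambda>x. x * exp (K x)) x"
          using DERIV_isCont[OF K[OF \<open>0 < x\<close>]] by (intro continuous_intros) auto
        moreover have "\<forall>\<^sub>F y in nhds x. y * exp (K y) = q y"
          using eventually_nhds_in_open[of "{0<..}" x] \<open>0 < x\<close>
          by (auto elim!: eventually_mono simp: q_def)
        ultimately have "isCont q x" by (simp add: isCont_cong)
        then show ?thesis by (rule continuous_at_imp_continuous_within)
      qed
    qed
  qed
  moreover have "exp (f X * (y - x)) * q x \<le> q y"
    if X: "0 < X" "X \<le> x" "x < y" "y \<le> 2 * X" for X x y
  proof -
    obtain z where z: "x < z" "z < y" "K y - K x = (y - x) * k z" using Kmvt[of x y] X by auto
    have "f X * (y - x) \<le> k z * (y - x)"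
      using k(3)[of X z] z that by (intro mult_right_mono) auto
    then have "exp (f X * (y - x)) * exp (K x) \<le> exp (K y)"
      using z by (simp add: algebra_simps flip: exp_add)
    then have "x * (exp (f X * (y - x)) * exp (K x)) \<le> y * exp (K y)"
      using that by (intro mult_mono) auto
    then show ?thesis using that by (simp add: q_pos mult_ac)
  qed
  ultimately show ?thesis by blast
qed

section \<open>Time derivatives, gradients and continuously differentiable functions\<close>

lemma dtime_eq:
  assumes "0 \<le> t" "(w has_vector_derivative d) (at t within {0..})"
  shows "dtime w t = d"
proof -
  have "at_right t \<le> at t within {0..}" using assms(1) by (intro at_le) auto
  then have "at t within {0..} \<noteq> bot"
    using trivial_limit_at_right_real[of t] by (metis bot.extremum_uniqueI trivial_limit_def)
  then show ?thesis unfolding dtime_def using assms(2) by (rule vector_derivative_within)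
qed

lemma grad_eq:
  assumes "GDERIV f x :> D"
  shows "grad f x = D"
  unfolding grad_def
proof (rule the_equality[where P = "\<lambda>D. GDERIV f x :> D", OF assms])
  fix D' assume "GDERIV f x :> D'"
  then have "(\<lambda>h. h \<bullet> D') = (\<lambda>h. h \<bullet> D)"
    using assms unfolding gderiv_def by (rule has_derivative_unique)
  then show "D' = D" by (metis vector_eq_ldot)
qed

text \<open>The total derivative is restricted to the two coordinate slices. The half-space is full
  in \<open>z\<close>, so the spatial derivative is two-sided even at time 0; the vector
  \<open>g\<close> in the proof represents it as an inner product.\<close>

lemma C1_on_partial_derivatives:
  fixes V :: "real \<Rightarrow> 'z::euclidean_space \<Rightarrow> real"
  assumes V: "C1_on (\<lambda>(t, z). V t z) ({0..} \<times> UNIV)" and t: "0 \<le> t"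
  shows "((\<lambda>s. V s z) has_real_derivative dtime (\<lambda>s. V s z) t) (at t within {0..})"
    and "GDERIV (V t) z :> grad (V t) z"
proof -
  obtain D where "((\<lambda>(t, z). V t z) has_derivative blinfun_apply D) (at (t, z) within {0..} \<times> UNIV)"
    using V t unfolding C1_on_def by blast
  note D = has_derivative_subset[OF this]
  have "((\<lambda>s. case (s, z) of (t, z) \<Rightarrow> V t z) has_derivative (\<lambda>h. D (h, 0))) (at t within {0..})"
    by (rule has_derivative_in_compose[where f = "\<lambda>s. (s, z)" and f' = "\<lambda>h. (h, 0)", OF _ D])
       (auto intro!: derivative_eq_intros)
  moreover have "(\<lambda>h. D (h, 0)) = (\<lambda>h. h *\<^sub>R D (1, 0))"
  proof
    show "D (h, 0) = h *\<^sub>R D (1, 0)" for h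
      using blinfun.scaleR_right[of D h "(1, 0)"] by (simp only: scaleR_Pair scaleR_zero_right) simp
  qed
  ultimately have T: "((\<lambda>s. V s z) has_vector_derivative D (1, 0)) (at t within {0..})"
    unfolding has_vector_derivative_def by (simp only: prod.case)
  then show "((\<lambda>s. V s z) has_real_derivative dtime (\<lambda>s. V s z) t) (at t within {0..})"
    unfolding has_real_derivative_iff_has_vector_derivative by (simp only: dtime_eq[OF t T])
  have Z: "((\<lambda>y. case (t, y) of (t, z) \<Rightarrow> V t z) has_derivative (\<lambda>h. D (0, h))) (at z)"
    by (rule has_derivative_in_compose[where f = "\<lambda>y. (t, y)" and f' = "\<lambda>h. (0, h)", OF _ D])
       (auto intro!: derivative_eq_intros simp: t)
  define g where "g = (\<Sum>b\<in>Basis. D (0, b) *\<^sub>R b)"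
  have "D (0, h) = h \<bullet> g" for h
  proof -
    have "D (0, h) = D (0, \<Sum>b\<in>Basis. (h \<bullet> b) *\<^sub>R b)" by (simp add: euclidean_representation)
    also have "\<dots> = (\<Sum>b\<in>Basis. (h \<bullet> b) *\<^sub>R D (0, b))"
    proof -
      have l: "linear (\<lambda>h. D (0, h))"
        using Z by (rule has_derivative_linear)
      show ?thesis
        unfolding linear_sum[OF l, of "\<lambda>b. (h \<bullet> b) *\<^sub>R b" Basis] linear_scale[OF l] ..
    qed
    finally show ?thesis by (simp add: g_def inner_sum_right mult.commute)
  qed
  then have "GDERIV (V t) z :> g" using Z by (simp add: gderiv_def)
  then show "GDERIV (V t) z :> grad (V t) z" using grad_eq by fastforce
qed

lemma C1_on_add:
  assumes "C1_on f S" "C1_on g S"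
  shows "C1_on (\<lambda>x. f x + g x) S"
proof -
  obtain f' g' where
    "\<forall>x\<in>S. (f has_derivative blinfun_apply (f' x)) (at x within S)" "continuous_on S f'"
    "\<forall>x\<in>S. (g has_derivative blinfun_apply (g' x)) (at x within S)" "continuous_on S g'"
    using assms unfolding C1_on_def by blast
  then show ?thesis
    unfolding C1_on_def
    by (intro exI[of _ "\<lambda>x. f' x + g' x"] conjI ballI continuous_intros)
       (auto simp: blinfun.add_left[abs_def] plus_blinfun.rep_eq intro!: has_derivative_add)
qed

lemma C1_on_compose_linear:
  assumes f: "C1_on f T" and L: "bounded_linear L" and LS: "L ` S \<subseteq> T"
  shows "C1_on (\<lambda>x. f (L x)) S"
proof -
  obtain f' where f': "\<And>x. x \<in> T \<Longrightarrow> (f has_derivative blinfun_apply (f' x)) (at x within T)"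
    "continuous_on T f'"
    using f unfolding C1_on_def by blast
  show ?thesis
    unfolding C1_on_def
  proof (intro exI[of _ "\<lambda>x. f' (L x) o\<^sub>L Blinfun L"] conjI ballI)
    fix x assume x: "x \<in> S"
    have "(f has_derivative f' (L x)) (at (L x) within L ` S)"
      using f'(1)[of "L x"] x LS by (blast intro: has_derivative_subset)
    from has_derivative_in_compose[OF bounded_linear_imp_has_derivative[OF L] this]
    show "((\<lambda>x. f (L x)) has_derivative blinfun_apply (f' (L x) o\<^sub>L Blinfun L)) (at x within S)"
      by (simp add: blinfun_compose.rep_eq bounded_linear_Blinfun_apply[OF L] comp_def)
  next
    show "continuous_on S (\<lambda>x. f' (L x) o\<^sub>L Blinfun L)"
      by (intro continuous_intros continuous_on_compose2[OF f'(2)]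
          linear_continuous_on[OF L]) (use LS in auto)
  qed
qed

lemma C1_on_compose_real:
  fixes f :: "'a::real_normed_vector \<Rightarrow> real"
  assumes f: "C1_on f S"
    and Q: "\<And>v. (Q has_real_derivative p v) (at v)" and p: "continuous_on UNIV p"
  shows "C1_on (\<lambda>x. Q (f x)) S"
proof -
  obtain f' where f': "\<And>x. x \<in> S \<Longrightarrow> (f has_derivative blinfun_apply (f' x)) (at x within S)"
    "continuous_on S f'"
    using f unfolding C1_on_def by blast
  have "continuous_on S f" by (rule has_derivative_continuous_on[OF f'(1)])
  then have pf: "continuous_on S (\<lambda>x. p (f x))"
    by (rule continuous_on_compose2[OF p]) auto
  show ?thesis
    unfolding C1_on_def
  proof (intro exI[of _ "\<lambda>x. p (f x) *\<^sub>R f' x"] conjI ballI)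
    fix x assume x: "x \<in> S"
    have "(Q has_derivative (\<lambda>h. p (f x) * h)) (at (f x) within f ` S)"
      using Q[of "f x"] by (auto simp: has_field_derivative_def intro: has_derivative_at_withinI)
    from has_derivative_in_compose[OF f'(1)[OF x] this]
    show "((\<lambda>x. Q (f x)) has_derivative blinfun_apply (p (f x) *\<^sub>R f' x)) (at x within S)"
      by (simp add: scaleR_blinfun.rep_eq)
  next
    show "continuous_on S (\<lambda>x. p (f x) *\<^sub>R f' x)" using pf f'(2) by (intro continuous_intros)
  qed
qed

section \<open>A small-gain criterion for uniform input-to-state stability\<close>

text \<open>Estimates produce a threshold on the norm of the state, whereas stability asks for one
  on the value of \<open>V\<close>. The upper bound \<open>au\<close> converts between them: with
  \<open>\<sigma>\<close> the composition of \<open>au\<close>, the inverse of \<open>b\<close>, and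
  \<open>\<rho>\<close>, a large \<open>V\<close> forces a large state.\<close>

lemma uniformly_ISS_I:
  fixes f :: "real \<Rightarrow> 'z::euclidean_space \<Rightarrow> 'd::real_normed_vector \<Rightarrow> 'z"
  assumes V: "C1_on (\<lambda>(t, z). V t z) ({0..} \<times> UNIV)"
    and al: "class_Kinf al" and au: "class_Kinf au" and b: "class_Kinf b" and k: "class_Kinf k"
    and \<rho>: "class_K \<rho>"
    and bounds: "\<And>t z. 0 \<le> t \<Longrightarrow> al (norm z) \<le> V t z" "\<And>t z. 0 \<le> t \<Longrightarrow> V t z \<le> au (norm z)"
    and decay: "\<And>t z d. 0 \<le> t \<Longrightarrow> \<rho> (norm d) \<le> b (norm z) \<Longrightarrow>
      deriv_along V t z (f t z d) \<le> - k (norm z)"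
  shows "uniformly_ISS f"
proof -
  let ?bi = "inv_into {0..} b"
  have bi: "class_Kinf ?bi" and b_bi: "\<And>x. 0 \<le> x \<Longrightarrow> b (?bi x) = x"
    using class_Kinf_inv[OF b] by auto
  define \<sigma> where "\<sigma> = (\<lambda>r. au (?bi (\<rho> r)))"
  have "class_K \<sigma>"
    unfolding \<sigma>_def
    by (rule class_K_comp[OF class_Kinf_K[OF au] class_K_comp[OF class_Kinf_K[OF bi] \<rho>]])
  moreover have "deriv_along V t z (f t z d) \<le> - k (norm z)"
    if "0 \<le> t" "\<sigma> (norm d) \<le> V t z" for t z d
  proof (rule decay[OF that(1)])
    define r where "r = ?bi (\<rho> (norm d))"
    have rho0: "0 \<le> \<rho> (norm d)" using class_K_D(4)[OF \<rho>] by simp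
    have r: "0 \<le> r" using class_Kinf_D(4)[OF bi rho0] by (simp add: r_def)
    have "au r \<le> au (norm z)" using that bounds(2)[of t z] by (simp add: \<sigma>_def r_def)
    then have "r \<le> norm z" using class_Kinf_D(6)[OF au, of "norm z" r] r by fastforce
    then show "\<rho> (norm d) \<le> b (norm z)"
      using class_Kinf_D(5)[OF b r] b_bi[OF rho0] by (simp add: r_def)
  qed
  moreover have "0 \<le> V t z" if "0 \<le> t" for t z
    using bounds(1)[OF that, of z] class_Kinf_D(4)[OF al, of "norm z"] by simp
  ultimately show ?thesis
    unfolding uniformly_ISS_def
    by (intro exI[of _ V] exI[of _ al] exI[of _ au] exI[of _ k] exI[of _ \<sigma>] conjI)
       (auto simp: V al au k bounds)
qed

text \<open>Boundedness of \<open>g\<close> is what makes the margin unbounded: once \<open>g t\<close> is close to its supremum,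
  any increase of the argument is harmless.\<close>

lemma gain_margin:
  assumes g: "class_K g" and bound: "\<And>s. 0 \<le> s \<Longrightarrow> g s \<le> L" and \<tau>: "1 < \<tau>"
  shows "\<exists>m. class_Kinf m \<and> (\<forall>t\<ge>0. m t \<le> t) \<and> (\<forall>t\<ge>0. g (t + m t) \<le> \<tau> * g t)"
proof -
  define P where "P = (\<lambda>t c. 0 \<le> t \<longrightarrow> 0 \<le> c \<longrightarrow> g (t + c) \<le> \<tau> * g t)"
  define S where "S = Sup (g ` {0..})"
  have bdd: "bdd_above (g ` {0..})" using bound by (intro bdd_aboveI2) auto
  have S: "g s \<le> S" if "0 \<le> s" for s unfolding S_def using that by (intro cSUP_upper bdd) auto
  have "0 < S" using S[of 1] class_K_D(7)[OF g, of 1] by simp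
  then have "S / \<tau> < S" using \<tau> by (simp add: divide_less_eq)
  then obtain T0 where T0: "0 \<le> T0" "S / \<tau> < g T0"
    unfolding S_def using less_cSUP_iff[OF _ bdd, of "Sup (g ` {0..}) / \<tau>"] by auto
  \<comment> \<open>The added 1 makes \<open>T\<close> positive, as
    \<open>class_Kinf_minorant\<close> demands.\<close>
  define T where "T = T0 + 1"
  have far: "P t c" if "T \<le> t" for t c
  proof -
    have "S / \<tau> < g t" using T0 that class_K_D(5)[OF g, of T0 t] by (simp add: T_def)
    then have "S \<le> \<tau> * g t" using \<tau> by (simp add: field_simps)
    then show ?thesis using S[of "t + c"] by (auto simp: P_def)
  qed
  have "\<exists>m. class_Kinf m \<and> (\<forall>t>0. P t (m t)) \<and> (\<forall>t\<ge>0. m t \<le> t)"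
  proof (rule class_Kinf_minorant)
    show "P t c'" if "P t c" "0 \<le> c'" "c' \<le> c" for t c c'
      using that class_K_D(5)[OF g, of "t + c'" "t + c"] by (auto simp: P_def)
    show "\<exists>s>0. \<forall>t\<ge>s. P t M" for M
      using far T0 by (intro exI[of _ T]) (auto simp: T_def)
    fix s :: real assume s: "0 < s"
    \<comment> \<open>Only \<open>s \<le> t < T\<close> is left, and \<open>c \<le> 1\<close> keeps
      \<open>t + c\<close> in the compact interval. The tolerance is measured against
      \<open>g s\<close>, the least value of \<open>g\<close> on that range.\<close>
    have "uniformly_continuous_on {0..T + 1} g"
      by (intro compact_uniformly_continuous continuous_on_subset[OF class_K_D(1)[OF g]]) auto
    moreover have "0 < (\<tau> - 1) * g s" using \<tau> class_K_D(7)[OF g s] by simp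
    ultimately obtain d where d: "0 < d"
      "\<And>x y. x \<in> {0..T+1} \<Longrightarrow> y \<in> {0..T+1} \<Longrightarrow> dist y x < d \<Longrightarrow> dist (g y) (g x) < (\<tau> - 1) * g s"
      unfolding uniformly_continuous_on_def by metis
    define c where "c = min (d / 2) 1"
    have c: "0 < c" "c < d" "c \<le> 1" using d(1) by (auto simp: c_def)
    have "P t c" if t: "s \<le> t" for t
    proof (cases "T \<le> t")
      case False
      have "g (t + c) - g t < (\<tau> - 1) * g s"
        using d(2)[of t "t + c"] False c t s by (auto simp: dist_real_def)
      also have "\<dots> \<le> (\<tau> - 1) * g t"
        using \<tau> class_K_D(5)[OF g, of s t] s t by (intro mult_left_mono) auto
      finally show ?thesis by (simp add: P_def algebra_simps)
    qed (rule far)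
    then show "\<exists>c>0. \<forall>t\<ge>s. P t c" using c(1) by blast
  qed
  then obtain m where m: "class_Kinf m" "\<forall>t>0. P t (m t)" "\<forall>t\<ge>0. m t \<le> t" by blast
  have "g (t + m t) \<le> \<tau> * g t" if "0 \<le> t" for t
  proof (cases "t = 0")
    case True
    then show ?thesis using class_Kinf_D(3)[OF m(1)] class_K_D(3)[OF g] by simp
  next
    case False
    then show ?thesis using that m(2) class_Kinf_D(4)[OF m(1) that] by (auto simp: P_def)
  qed
  then show ?thesis using m by blast
qed

text \<open>Continuing \<open>p\<close> by 0 to the left makes the derivative two-sided on the whole
  line, so that the chain rule applies also where the inner function is 0. The antiderivative is
  unbounded because its slope is at least \<open>p 1\<close> beyond 1.\<close>

lemma class_K_antiderivative:
  assumes p: "class_K p"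
  shows "\<exists>Q. class_Kinf Q \<and> (\<forall>v. (Q has_real_derivative p (max v 0)) (at v))"
proof -
  have cont: "continuous_on UNIV (\<lambda>v. p (max v 0))"
    by (rule continuous_on_compose2[OF class_K_D(1)[OF p]]) (auto intro!: continuous_intros)
  have "\<exists>F. \<forall>x :: real. - \<infinity> < ereal x \<longrightarrow> ereal x < \<infinity> \<longrightarrow> (F has_vector_derivative p (max x 0)) (at x)"
    using cont by (intro einterval_antiderivative) (auto simp: continuous_on_eq_continuous_at)
  then obtain F where F: "\<And>v. (F has_real_derivative p (max v 0)) (at v)"
    by (auto simp: has_real_derivative_iff_has_vector_derivative)
  define Q where "Q = (\<lambda>v. F v - F 0)"
  have Q: "(Q has_real_derivative p (max v 0)) (at v)" for v
    unfolding Q_def using F by (auto intro!: derivative_eq_intros)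
  have mvt: "\<exists>z. x < z \<and> z < y \<and> Q y - Q x = (y - x) * p (max z 0)" if "x < y" for x y
    using MVT2[OF that, of Q "\<lambda>v. p (max v 0)"] Q by blast
  have "class_Kinf Q"
    unfolding class_Kinf_iff
  proof (intro conjI allI)
    show "class_K Q"
    proof (rule class_KI)
      show "continuous_on {0..} Q"
        using Q by (intro continuous_at_imp_continuous_on) (auto intro: DERIV_isCont)
      show "Q 0 = 0" by (simp add: Q_def)
      fix x y :: real assume xy: "0 \<le> x" "x < y"
      obtain z where z: "x < z" "Q y - Q x = (y - x) * p (max z 0)" using mvt[OF xy(2)] by blast
      have "0 < (y - x) * p (max z 0)" using class_K_D(7)[OF p, of z] z(1) xy by (simp add: max_def)
      then show "Q x < Q y" using z(2) by linarith
    qed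
    note K = class_K_D[OF this]
    fix M :: real
    have p1: "0 < p 1" using class_K_D(7)[OF p] by simp
    define y where "y = 2 + \<bar>M\<bar> / p 1"
    have y: "1 < y" using p1 by (simp add: y_def add_pos_nonneg)
    obtain z where z: "1 < z" "Q y - Q 1 = (y - 1) * p (max z 0)" using mvt[OF y] by blast
    have "\<bar>M\<bar> \<le> (y - 1) * p 1" using p1 by (simp add: y_def field_simps)
    also have "\<dots> \<le> (y - 1) * p (max z 0)"
      using y z(1) class_K_D(5)[OF p, of 1 z] by (intro mult_left_mono) auto
    finally show "\<exists>s\<ge>0. M \<le> Q s" using z(2) K(4)[of 1] y by (intro exI[of _ y]) auto
  qed
  then show ?thesis using Q by blast
qed

text \<open>The pointwise core of the argument, with \<open>x\<close> and \<open>y\<close> the two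
  scales, \<open>D\<close> and \<open>E\<close> the derivatives of the two functions,
  \<open>s\<close> the norm of the parameter error and \<open>u\<close> the size of the disturbance.
  Below, inside and above the overlap the weights let the guaranteed decrease pay for the other
  term.\<close>

lemma composite_decay:
  fixes q m A B :: "real \<Rightarrow> real"
  assumes q: "class_K q" and m: "class_Kinf m" "\<And>t. 0 \<le> t \<Longrightarrow> m t \<le> t" and A: "class_Kinf A"
    and pos: "0 < c" "0 < g" "0 < k" "0 < b"
    and growth:
      "\<And>x. 0 < x \<Longrightarrow> 4 * g * x\<^sup>2 * q (x + m x / 3) \<le> c * A x * q (x + 2 * m x / 3)"
      "\<And>x. 0 < x \<Longrightarrow> 2 * x * k * q (x + m x / 3) \<le> q (x + 2 * m x / 3)"
      "\<And>x. 0 < x \<Longrightarrow> 2 * B x * q (x + 2 * m x / 3) \<le> b * x * g * m x * q (x + m x)"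
      "\<And>x. 0 < x \<Longrightarrow> q (x + 2 * m x / 3) \<le> b * x * k * q (x + m x)"
    and xy: "0 \<le> x" "0 \<le> y" "b * y \<le> s" "s \<le> y" "0 \<le> u"
    and D: "y \<le> x + m x \<Longrightarrow> D \<le> - c * A x + u" "D \<le> B x + u"
    and E: "E \<le> s * (g * (x - y) + k * u)"
    and t: "0 \<le> t" "t \<le> max x y"
    and u: "u \<le> c / 8 * A (t / 2)" "u \<le> g / (8 * k) * m (t / 2)"
  shows "q (x + 2 * m x / 3) * D + q y * E
    \<le> - min (q (t / 2) * (c / 4 * A (t / 2))) (q (t / 2) * (t / 2) * (b * g / 2 * m (t / 2)))"
proof -
  note qm = class_K_D(5)[OF q] and q0 = class_K_D(4)[OF q]
  note mm = class_Kinf_D(5)[OF m(1)] and m0 = class_Kinf_D(4)[OF m(1)]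
  note Am = class_Kinf_D(5)[OF A] and A0 = class_Kinf_D(4)[OF A]
  have s0: "0 \<le> s" using xy pos by (meson mult_nonneg_nonneg less_imp_le order_trans)
  have mx: "0 \<le> m x" "m x \<le> x" using m0 m(2) xy by auto
  have ku: "k * u \<le> g * m (t / 2) / 8" using u(2) pos by (simp add: field_simps)
  \<comment> \<open>Common end of the two cases with \<open>y \<le> x + m x\<close>: there
    \<open>max x y \<le> 2 * x\<close> because \<open>m x \<le> x\<close>, hence
    \<open>t / 2 \<le> x\<close>. The bound on \<open>u\<close> consumes half of the remaining
    decrease.\<close>
  have near: ?thesis if *: "t / 2 \<le> x" "q (x + 2 * m x / 3) * D + q y * E \<le> q (x + 2 * m x / 3) * (- c / 2 * A x + 2 * u)"
  proof -
    have "- c / 2 * A x + 2 * u \<le> - (c / 4 * A (t / 2))"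
    proof -
      have "c * A (t / 2) \<le> c * A x" using Am[of "t / 2" x] * t pos by simp
      then show ?thesis using u(1) by simp
    qed
    then have "q (x + 2 * m x / 3) * (- c / 2 * A x + 2 * u) \<le> q (x + 2 * m x / 3) * - (c / 4 * A (t / 2))"
      using q0 mx xy by (intro mult_left_mono) auto
    also have "\<dots> \<le> - (q (t / 2) * (c / 4 * A (t / 2)))"
    proof -
      have "q (t / 2) * (c / 4 * A (t / 2)) \<le> q (x + 2 * m x / 3) * (c / 4 * A (t / 2))"
        using qm[of "t / 2" "x + 2 * m x / 3"] * mx t A0[of "t / 2"] pos by (intro mult_right_mono) auto
      then show ?thesis by simp
    qed
    finally show ?thesis using * by linarith
  qed
  consider "x = 0" "y = 0" | "0 < x" "y \<le> x + m x / 3" | "0 < x" "x + m x / 3 \<le> y" "y \<le> x + m x"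
    | "x + m x \<le> y" "0 < y"
    using xy mx by fastforce
  then show ?thesis
  proof cases
    case 1
    then have "t = 0" using t by simp
    then show ?thesis using 1 class_K_D(3)[OF q] class_Kinf_D(3)[OF m(1)] by simp
  next
    case 2
    have x: "t / 2 \<le> x" using t 2 mx by auto
    \<comment> \<open>Below the overlap \<open>E\<close> may be positive, but
      \<open>s \<le> y \<le> 2 * x\<close> and \<open>q y \<le> q (x + m x / 3)\<close>. The first
      two growth conditions absorb the result into half of the decrease of \<open>D\<close> and one
      further \<open>u\<close>.\<close>
    have "q y * E \<le> q (x + m x / 3) * (2 * x * (g * x + k * u))"
    proof (cases "E \<le> 0")
      case True
      have "q y * E \<le> 0" using q0[of y] xy True by (simp add: mult_nonneg_nonpos)
      also have "0 \<le> q (x + m x / 3) * (2 * x * (g * x + k * u))"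
        using q0 mx xy pos by (intro mult_nonneg_nonneg add_nonneg_nonneg) auto
      finally show ?thesis .
    next
      case False
      have "E \<le> s * (g * x + k * u)"
      proof -
        have "g * (x - y) \<le> g * x" using pos xy by (intro mult_left_mono) auto
        then show ?thesis using E s0 mult_left_mono[of "g * (x - y) + k * u" "g * x + k * u" s] by linarith
      qed
      also have "\<dots> \<le> 2 * x * (g * x + k * u)"
        using xy 2 mx pos by (intro mult_right_mono add_nonneg_nonneg) auto
      finally have "E \<le> 2 * x * (g * x + k * u)" .
      then show ?thesis using False qm[of y "x + m x / 3"] q0 mx xy 2 by (intro mult_mono) auto
    qed
    also have "\<dots> = (4 * g * x\<^sup>2 * q (x + m x / 3)) / 2 + (2 * x * k * q (x + m x / 3)) * u"
      by (simp add: algebra_simps power2_eq_square)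
    also have "\<dots> \<le> (c * A x * q (x + 2 * m x / 3)) / 2 + q (x + 2 * m x / 3) * u"
      using growth(1,2)[OF 2(1)] xy by (intro add_mono divide_right_mono mult_right_mono) auto
    finally have "q y * E \<le> q (x + 2 * m x / 3) * (c / 2 * A x + u)" by (simp add: algebra_simps)
    moreover have "q (x + 2 * m x / 3) * D \<le> q (x + 2 * m x / 3) * (- c * A x + u)"
      using D(1) 2 mx q0 xy by (intro mult_left_mono) auto
    ultimately show ?thesis by (intro near x) (simp add: algebra_simps)
  next
    case 3
    have x: "t / 2 \<le> x" using t 3 mx by auto
    \<comment> \<open>Inside the overlap the gap \<open>y - x \<ge> m x / 3\<close> outweighs the
      disturbance, which is at most an eighth of \<open>g * m (t / 2)\<close>.\<close>
    have "g * (x - y) + k * u \<le> 0"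
    proof -
      have "g * (x - y) \<le> g * - (m x / 3)" using 3 pos by (intro mult_left_mono) auto
      moreover have "g * m (t / 2) \<le> g * m x" using mm[of "t / 2" x] x t pos by simp
      moreover have "0 \<le> g * m x" using pos mx by simp
      ultimately show ?thesis using ku by simp
    qed
    then have "E \<le> 0" using E s0 mult_nonneg_nonpos[of s "g * (x - y) + k * u"] by linarith
    then have "q y * E \<le> 0" using q0[of y] xy by (simp add: mult_nonneg_nonpos)
    moreover have "q (x + 2 * m x / 3) * D \<le> q (x + 2 * m x / 3) * (- c / 2 * A x + 2 * u)"
    proof -
      have "0 \<le> c * A x" using A0 xy pos by simp
      then have "D \<le> - c / 2 * A x + 2 * u" using D(1) 3 xy by simp
      then show ?thesis using q0 mx xy by (intro mult_left_mono) auto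
    qed
    ultimately show ?thesis by (intro near x) simp
  next
    case 4
    have "t \<le> y" using t 4 mx xy by auto
    \<comment> \<open>If \<open>x \<le> t / 2\<close>, then \<open>m (t / 2) \<le> t / 2\<close> is
      already below the gap, since \<open>t \<le> y\<close>; otherwise monotonicity of
      \<open>m\<close> and \<open>m x \<le> y - x\<close> suffice.\<close>
    have my: "m (t / 2) \<le> y - x"
    proof (cases "x \<le> t / 2")
      case True
      then show ?thesis using m(2)[of "t / 2"] t xy \<open>t \<le> y\<close> by auto
    next
      case False
      then show ?thesis using mm[of "t / 2" x] 4 t by auto
    qed
    have "q (x + 2 * m x / 3) * D \<le> q (x + 2 * m x / 3) * (B x + u)"
      using D(2) mx q0 xy by (intro mult_left_mono) auto
    \<comment> \<open>Above the overlap the last two growth conditions charge the increase of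
      \<open>D\<close> to half of the decrease of \<open>E\<close>, leaving the other half against
      \<open>2 * k * u\<close>.\<close>
    also have "\<dots> \<le> q y * s * (g * (y - x) / 2 + k * u)"
    proof (cases "x = 0")
      case True
      then show ?thesis
        using class_K_D(3)[OF q] class_Kinf_D(3)[OF m(1)] q0 xy s0 pos by simp
    next
      case False
      then have x: "0 < x" using xy by simp
      have qy: "q (x + m x) \<le> q y" using qm 4 mx xy by auto
      have "b * x \<le> b * y" using 4 mx pos by (intro mult_left_mono) auto
      then have bx: "b * x \<le> s" using xy by simp
      have "2 * B x * q (x + 2 * m x / 3) \<le> (b * x) * (g * m x) * q (x + m x)"
        using growth(3)[OF x] by (simp add: mult_ac)
      also have "\<dots> \<le> s * (g * (y - x)) * q y"
        using bx qy 4 mx xy s0 pos q0 by (intro mult_mono mult_nonneg_nonneg) auto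
      finally have 1: "q (x + 2 * m x / 3) * B x \<le> q y * s * (g * (y - x) / 2)"
        by (simp add: mult_ac)
      have "q (x + 2 * m x / 3) \<le> (b * x) * k * q (x + m x)" using growth(4)[OF x] .
      also have "\<dots> \<le> s * k * q y"
        using bx qy 4 mx xy s0 pos q0 by (intro mult_mono mult_nonneg_nonneg) auto
      also have "\<dots> = q y * (s * k)" by (simp only: mult_ac)
      finally have "q (x + 2 * m x / 3) * u \<le> q y * (s * k) * u" using xy by (intro mult_right_mono) auto
      from add_mono[OF 1 this] show ?thesis by (simp only: distrib_left mult.assoc)
    qed
    finally have "q (x + 2 * m x / 3) * D + q y * E
        \<le> q y * s * (g * (y - x) / 2 + k * u) + q y * (s * (g * (x - y) + k * u))"
      using E q0[of y] xy by (intro add_mono mult_left_mono) auto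
    also have "\<dots> = q y * s * - (g * (y - x) / 2 - 2 * (k * u))" by (simp add: algebra_simps)
    also have "\<dots> \<le> q y * s * - (g * m (t / 2) / 4)"
    proof -
      have "g * m (t / 2) \<le> g * (y - x)" using my pos by simp
      then show ?thesis using ku q0 xy s0 by (intro mult_left_mono mult_nonneg_nonneg) auto
    qed
    also have "\<dots> \<le> - (q (t / 2) * (t / 2) * (b * g / 2 * m (t / 2)))"
    proof -
      have "b * t \<le> b * y" using \<open>t \<le> y\<close> pos by (intro mult_left_mono) auto
      then have "b * t \<le> s" using xy by simp
      then have "q (t / 2) * (b * t) \<le> q y * s"
        using qm[of "t / 2" y] q0[of y] t \<open>t \<le> y\<close> pos xy by (intro mult_mono) auto
      then have "q (t / 2) * (b * t) * (g * m (t / 2) / 4) \<le> q y * s * (g * m (t / 2) / 4)"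
        using m0[of "t / 2"] t pos by (intro mult_right_mono) auto
      then show ?thesis by (simp add: algebra_simps)
    qed
    finally show ?thesis by linarith
  qed
qed

lemma deriv_along_sum_compose:
  fixes V :: "real \<Rightarrow> 'x::euclidean_space \<Rightarrow> real" and W :: "real \<Rightarrow> 'p::euclidean_space \<Rightarrow> real"
  assumes V: "C1_on (\<lambda>(t, x). V t x) ({0..} \<times> UNIV)" and W: "C1_on (\<lambda>(t, p). W t p) ({0..} \<times> UNIV)"
    and Q: "\<And>v. (Q has_real_derivative Q' v) (at v)" and R: "\<And>w. (R has_real_derivative R' w) (at w)"
    and t: "0 \<le> t"
  shows "deriv_along (\<lambda>t z. Q (V t (fst z)) + R (W t (snd z))) t z h
    = Q' (V t (fst z)) * deriv_along V t (fst z) (fst h) + R' (W t (snd z)) * deriv_along W t (snd z) (snd h)"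
proof -
  note Vd = C1_on_partial_derivatives[OF V t] and Wd = C1_on_partial_derivatives[OF W t]
  have "((\<lambda>s. Q (V s (fst z)) + R (W s (snd z))) has_real_derivative
      Q' (V t (fst z)) * dtime (\<lambda>s. V s (fst z)) t + R' (W t (snd z)) * dtime (\<lambda>s. W s (snd z)) t)
      (at t within {0..})"
    by (intro DERIV_add DERIV_chain2[OF Q Vd(1)] DERIV_chain2[OF R Wd(1)])
  then have 1: "dtime (\<lambda>s. Q (V s (fst z)) + R (W s (snd z))) t
      = Q' (V t (fst z)) * dtime (\<lambda>s. V s (fst z)) t + R' (W t (snd z)) * dtime (\<lambda>s. W s (snd z)) t"
    by (intro dtime_eq[OF t]) (simp add: has_real_derivative_iff_has_vector_derivative)
  have GV: "GDERIV (\<lambda>x. Q (V t x)) x :> Q' (V t x) *\<^sub>R grad (V t) x" for x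
    by (rule GDERIV_DERIV_compose[OF Vd(2) Q])
  have GW: "GDERIV (\<lambda>x. R (W t x)) x :> R' (W t x) *\<^sub>R grad (W t) x" for x
    by (rule GDERIV_DERIV_compose[OF Wd(2) R])
  have "((\<lambda>z. Q (V t (fst z)) + R (W t (snd z))) has_derivative
      (\<lambda>h. fst h \<bullet> (Q' (V t (fst z)) *\<^sub>R grad (V t) (fst z))
         + snd h \<bullet> (R' (W t (snd z)) *\<^sub>R grad (W t) (snd z)))) (at z)"
    by (intro has_derivative_add
        has_derivative_compose[OF has_derivative_fst[OF has_derivative_ident] GV[unfolded gderiv_def]]
        has_derivative_compose[OF has_derivative_snd[OF has_derivative_ident] GW[unfolded gderiv_def]])
  then have "GDERIV (\<lambda>z. Q (V t (fst z)) + R (W t (snd z))) z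
      :> (Q' (V t (fst z)) *\<^sub>R grad (V t) (fst z), R' (W t (snd z)) *\<^sub>R grad (W t) (snd z))"
    by (simp add: gderiv_def inner_prod_def)
  from grad_eq[OF this] 1 show ?thesis
    unfolding deriv_along_def by (simp add: inner_prod_def algebra_simps)
qed

theorem small_gain_ISS:
  fixes f :: "real \<Rightarrow> 'x::euclidean_space \<times> 'p::euclidean_space \<Rightarrow> 'd::real_normed_vector \<Rightarrow> 'x \<times> 'p"
    and V :: "real \<Rightarrow> 'x \<Rightarrow> real" and W :: "real \<Rightarrow> 'p \<Rightarrow> real"
    and \<alpha>1 \<alpha>2 \<alpha>3 \<gamma> \<kappa> \<omega> \<rho> :: "real \<Rightarrow> real"
  assumes V: "C1_on (\<lambda>(t, x). V t x) ({0..} \<times> UNIV)" and W: "C1_on (\<lambda>(t, p). W t p) ({0..} \<times> UNIV)"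
    and alphas: "class_Kinf \<alpha>1" "class_Kinf \<alpha>2" "class_Kinf \<alpha>3"
    and V_bounds: "\<And>t x. 0 \<le> t \<Longrightarrow> \<alpha>1 (norm x) \<le> V t x" "\<And>t x. 0 \<le> t \<Longrightarrow> V t x \<le> \<alpha>2 (norm x)"
    and pos: "0 < a1" "0 < a2" "0 < a3" "0 < a4"
    and W_bounds: "\<And>t p. 0 \<le> t \<Longrightarrow> a1 * (norm p)\<^sup>2 \<le> W t p" "\<And>t p. 0 \<le> t \<Longrightarrow> W t p \<le> a2 * (norm p)\<^sup>2"
    and \<gamma>: "class_K \<gamma>" "\<And>s. 0 \<le> s \<Longrightarrow> \<gamma> s \<le> l" "0 \<le> l"
    and \<omega>: "class_SN \<omega>" and \<kappa>: "class_Kinf \<kappa>" and \<rho>: "class_K \<rho>"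
    and V_decay: "\<And>t x p d. 0 \<le> t \<Longrightarrow> deriv_along V t x (fst (f t (x, p) d))
        \<le> - \<alpha>3 (norm x) + \<omega> (norm x) * \<gamma> (norm p) + \<rho> (norm d)"
    and W_decay: "\<And>t x p d. 0 \<le> t \<Longrightarrow> deriv_along W t p (snd (f t (x, p) d))
        \<le> - a3 * (norm p)\<^sup>2 + a4 * norm p * (\<kappa> (norm x) + \<rho> (norm d))"
    and \<tau>: "1 < \<tau>"
    and small_gain: "\<And>s. 0 \<le> s \<Longrightarrow>
        \<tau> * \<gamma> (sqrt a2 * a4 / (sqrt a1 * a3) * \<kappa> (inv_into {0..} \<alpha>1 (\<alpha>2 s))) * \<omega> s \<le> \<alpha>3 s"
  shows "uniformly_ISS f"
proof -
  \<comment> \<open>\<open>b\<close> relates the scale \<open>y\<close> to the norm of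
    \<open>p\<close> by \<open>b * y \<le> norm p \<le> y\<close>; \<open>g\<close> is the decay
    rate of \<open>W\<close> in terms of \<open>y\<close>; \<open>a\<close> turns the coupling
    \<open>a4 * \<kappa>\<close> into \<open>g * (a * \<kappa>)\<close>, so that \<open>W\<close>
    sees \<open>g * (X - y)\<close>.\<close>
  define b where "b = sqrt a1 / sqrt a2"
  define g where "g = a3 * b"
  define a where "a = a4 / g"
  \<comment> \<open>The gain margin spends the factor \<open>(1 + \<tau>) / 2\<close> out of
    \<open>\<tau>\<close>; \<open>c\<close> is the fraction of \<open>\<alpha>3\<close> that
    remains.\<close>
  define c where "c = 1 - (1 + \<tau>) / 2 / \<tau>"
  have const_pos: "0 < b" "0 < g" "0 < a" "0 < c"
    using pos \<tau> by (auto simp: b_def g_def a_def c_def field_simps)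
  have a_eq: "sqrt a2 * a4 / (sqrt a1 * a3) = a"
    by (simp add: a_def g_def b_def mult.commute)
  define i1 where "i1 = inv_into {0..} \<alpha>1"
  define i2 where "i2 = inv_into {0..} \<alpha>2"
  \<comment> \<open>\<open>R\<close> recovers from \<open>X v\<close> the bound \<open>i1 v\<close>
    on the norm of \<open>x\<close>. Through it the decay rate \<open>A\<close> and the growth bound
    \<open>B\<close> become functions of the scale alone.\<close>
  define R where "R = (\<lambda>x. inv_into {0..} \<kappa> (1 / a * x))"
  note i1 = class_Kinf_inv[OF alphas(1), folded i1_def]
  note i2 = class_Kinf_inv[OF alphas(2), folded i2_def]
  have R: "class_Kinf R" unfolding R_def
    using const_pos by (intro class_Kinf_comp[OF class_Kinf_inv(3)[OF \<kappa>] class_Kinf_scale[OF class_Kinf_id]]) simp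
  define X where "X = (\<lambda>v. a * \<kappa> (i1 v))"
  have X: "class_Kinf X" unfolding X_def
    by (rule class_Kinf_scale[OF class_Kinf_comp[OF \<kappa> i1(3)] const_pos(3)])
  have RX: "R (X v) = i1 v" if "0 \<le> v" for v
    using class_Kinf_inv(2)[OF \<kappa>, of "i1 v"] class_Kinf_D(4)[OF i1(3) that] const_pos
    by (simp add: R_def X_def)
  define A where "A = (\<lambda>x. \<alpha>3 (i2 (\<alpha>1 (R x))))"
  have A: "class_Kinf A" unfolding A_def
    by (rule class_Kinf_comp[OF alphas(3) class_Kinf_comp[OF i2(3) class_Kinf_comp[OF alphas(1) R]]])
  define B where "B = (\<lambda>x. l * \<omega> (R x))"
  have \<omega>D: "continuous_on {0..} \<omega>" "\<And>x y. 0 \<le> x \<Longrightarrow> x \<le> y \<Longrightarrow> \<omega> x \<le> \<omega> y" "\<And>x. 0 \<le> x \<Longrightarrow> 0 \<le> \<omega> x"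
    using \<omega> by (auto simp: class_SN_def mono_on_def)
  have B0: "0 \<le> B x" if "0 \<le> x" for x
    using \<gamma>(3) \<omega>D(3) class_Kinf_D(4)[OF R that] by (simp add: B_def)
  have contB: "continuous_on {0<..} B" unfolding B_def
    by (intro continuous_intros continuous_on_compose2[OF \<omega>D(1)]
        continuous_on_subset[OF class_Kinf_D(1)[OF R]]) (auto simp: class_Kinf_D(4)[OF R])

  have "1 < (1 + \<tau>) / 2" using \<tau> by simp
  from gain_margin[OF \<gamma>(1,2) this] obtain m where m: "class_Kinf m" "\<And>t. 0 \<le> t \<Longrightarrow> m t \<le> t"
    "\<And>t. 0 \<le> t \<Longrightarrow> \<gamma> (t + m t) \<le> (1 + \<tau>) / 2 * \<gamma> t" by blast
  \<comment> \<open>Each summand after the first is the factor needed by one of the four growth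
    conditions of \<open>composite_decay\<close>; the leading 1 keeps the logarithm of
    \<open>C x\<close> nonnegative.\<close>
  define C where "C = (\<lambda>x. 1 + 4 * g * x\<^sup>2 / (c * A x) + 2 * x * a4
    + 2 * B x / (b * x * g * m x) + 1 / (b * x * a4))"
  have parts: "0 \<le> 4 * g * x\<^sup>2 / (c * A x)" "0 \<le> 2 * x * a4" "0 \<le> 2 * B x / (b * x * g * m x)"
    "0 \<le> 1 / (b * x * a4)" if "0 < x" for x
    using that B0[of x] class_Kinf_D(7)[OF A that] class_Kinf_D(7)[OF m(1) that] const_pos pos by auto
  have C: "1 \<le> C x" "4 * g * x\<^sup>2 \<le> c * A x * C x" "2 * x * a4 \<le> C x"
    "2 * B x \<le> b * x * g * m x * C x" "1 \<le> b * x * a4 * C x" if "0 < x" for x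
  proof -
    note p = parts[OF that]
    note mA = class_Kinf_D(7)[OF A that] class_Kinf_D(7)[OF m(1) that]
    show "1 \<le> C x" "2 * x * a4 \<le> C x" using p by (auto simp: C_def)
    have "4 * g * x\<^sup>2 / (c * A x) \<le> C x" "2 * B x / (b * x * g * m x) \<le> C x" "1 / (b * x * a4) \<le> C x"
      using p by (auto simp: C_def)
    moreover have "0 < c * A x" "0 < b * x * g * m x" "0 < b * x * a4" using mA that const_pos pos by auto
    ultimately show "4 * g * x\<^sup>2 \<le> c * A x * C x" "2 * B x \<le> b * x * g * m x * C x" "1 \<le> b * x * a4 * C x"
      by (auto simp: pos_divide_le_eq mult.commute)
  qed
  have "continuous_on {0<..} C" unfolding C_def
    using const_pos pos class_Kinf_D(7)[OF A] class_Kinf_D(7)[OF m(1)]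
    by (intro continuous_intros contB continuous_on_subset[OF class_Kinf_D(1)[OF A]]
        continuous_on_subset[OF class_Kinf_D(1)[OF m(1)]]) force+
  \<comment> \<open>At this rate the exponential gains exactly the factor \<open>C x\<close> over a
    third of the overlap, of length \<open>m x / 3\<close>. The overlap lies in
    \<open>[x, 2 * x]\<close> because \<open>m x \<le> x\<close>.\<close>
  then have "continuous_on {0<..} (\<lambda>x. 3 * ln (C x) / m x)"
    using C(1) class_Kinf_D(7)[OF m(1)]
    by (intro continuous_intros continuous_on_subset[OF class_Kinf_D(1)[OF m(1)]]) force+
  from class_K_rapid_growth[OF this] obtain q where q: "class_K q"
    and qC: "\<And>X x y. 0 < X \<Longrightarrow> X \<le> x \<Longrightarrow> x < y \<Longrightarrow> y \<le> 2 * X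
      \<Longrightarrow> exp (3 * ln (C X) / m X * (y - x)) * q x \<le> q y" by blast
  have q_step: "C x * q (x + m x / 3) \<le> q (x + 2 * m x / 3)" "C x * q (x + 2 * m x / 3) \<le> q (x + m x)"
    if "0 < x" for x
  proof -
    have mx: "0 < m x" "m x \<le> x" using class_Kinf_D(7)[OF m(1) that] m(2)[of x] that by auto
    have "3 * ln (C x) / m x * (x + 2 * m x / 3 - (x + m x / 3)) = ln (C x)"
      "3 * ln (C x) / m x * (x + m x - (x + 2 * m x / 3)) = ln (C x)"
      using mx by (simp_all add: field_simps)
    moreover have "exp (ln (C x)) = C x" using C(1)[OF that] by simp
    ultimately show "C x * q (x + m x / 3) \<le> q (x + 2 * m x / 3)" "C x * q (x + 2 * m x / 3) \<le> q (x + m x)"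
      using qC[of x "x + m x / 3" "x + 2 * m x / 3"] qC[of x "x + 2 * m x / 3" "x + m x"] mx that by auto
  qed
  have growth:
    "4 * g * x\<^sup>2 * q (x + m x / 3) \<le> c * A x * q (x + 2 * m x / 3)"
    "2 * x * a4 * q (x + m x / 3) \<le> q (x + 2 * m x / 3)"
    "2 * B x * q (x + 2 * m x / 3) \<le> b * x * g * m x * q (x + m x)"
    "q (x + 2 * m x / 3) \<le> b * x * a4 * q (x + m x)" if x: "0 < x" for x
  proof -
    have mx: "0 < m x" using class_Kinf_D(7)[OF m(1) x] .
    have Ax: "0 < A x" using class_Kinf_D(7)[OF A x] .
    have q0: "0 \<le> q (x + m x / 3)" "0 \<le> q (x + 2 * m x / 3)"
      using class_K_D(4)[OF q] mx x by auto
    have chain: "u * q' \<le> w * q''" if "u \<le> w * C x" "C x * q' \<le> q''" "0 \<le> w" "0 \<le> q'" for u w q' q''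
    proof -
      have "u * q' \<le> (w * C x) * q'" using that by (intro mult_right_mono)
      also have "\<dots> \<le> w * q''" using that(2,3) mult_left_mono[of "C x * q'" q'' w] by (simp add: mult_ac)
      finally show ?thesis .
    qed
    show "4 * g * x\<^sup>2 * q (x + m x / 3) \<le> c * A x * q (x + 2 * m x / 3)"
      using C(2)[OF x] q_step(1)[OF x] _ q0(1) by (rule chain) (use Ax const_pos in simp)
    show "2 * x * a4 * q (x + m x / 3) \<le> q (x + 2 * m x / 3)"
      using chain[of "2 * x * a4" 1] C(3)[OF x] q_step(1)[OF x] q0(1) by simp
    show "2 * B x * q (x + 2 * m x / 3) \<le> b * x * g * m x * q (x + m x)"
      using C(4)[OF x] q_step(2)[OF x] _ q0(2) by (rule chain) (use mx x const_pos in simp)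
    show "q (x + 2 * m x / 3) \<le> b * x * a4 * q (x + m x)"
      using chain[of 1 "b * x * a4"] C(5)[OF x] q_step(2)[OF x] q0(2) x const_pos pos by simp
  qed

  define p1 where "p1 = (\<lambda>v. q (X v + 2 / 3 * m (X v)))"
  define p2 where "p2 = (\<lambda>w. q (sqrt (1 / a1 * w)))"
  have "class_K (\<lambda>x. x + 2 / 3 * m x)"
    by (intro class_K_add class_K_scale class_Kinf_K[OF m(1)] class_Kinf_K[OF class_Kinf_id]) simp
  from class_K_comp[OF q class_K_comp[OF this class_Kinf_K[OF X]]] have p1: "class_K p1" by (simp add: p1_def)
  have p2: "class_K p2" unfolding p2_def
    using pos by (intro class_K_comp[OF q class_K_comp[OF class_Kinf_K[OF class_Kinf_sqrt] class_K_scale[OF class_Kinf_K[OF class_Kinf_id]]]]) simp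
  obtain Q where Q: "class_Kinf Q" "\<And>v. (Q has_real_derivative p1 (max v 0)) (at v)"
    using class_K_antiderivative[OF p1] by blast
  obtain P where P: "class_Kinf P" "\<And>w. (P has_real_derivative p2 (max w 0)) (at w)"
    using class_K_antiderivative[OF p2] by blast

  have scale_id: "class_Kinf (\<lambda>x. k * x)" if "0 < k" for k
    by (rule class_Kinf_scale[OF class_Kinf_id that])
  \<comment> \<open>One of the two components carries at least half of the norm of the pair, which
    explains the halved arguments and the minimum here and in \<open>\<eta>\<close>.\<close>
  define lo where "lo = (\<lambda>r. min (Q (\<alpha>1 (1 / 2 * r))) (P (a1 * (1 / 2 * r)\<^sup>2)))"
  define up where "up = (\<lambda>r. Q (\<alpha>2 r) + P (a2 * r\<^sup>2))"
  \<comment> \<open>Chosen so that \<open>2 * \<eta> (norm z)\<close> is a lower bound of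
    \<open>max X y\<close>: it plays the role of \<open>t\<close> in \<open>composite_decay\<close>,
    so \<open>t / 2\<close> there is \<open>\<eta>\<close> in \<open>thr\<close> and
    \<open>dec\<close>.\<close>
  define \<eta> where "\<eta> = (\<lambda>r. 1 / 2 * min (a * \<kappa> (1 / 2 * r)) (1 / 2 * r))"
  define thr where "thr = (\<lambda>r. min (c / 8 * A (\<eta> r)) (g / (8 * a4) * m (\<eta> r)))"
  define dec where "dec = (\<lambda>r. min (q (\<eta> r) * (c / 4 * A (\<eta> r))) (q (\<eta> r) * \<eta> r * (b * g / 2 * m (\<eta> r))))"
  have half: "class_Kinf (\<lambda>r. 1 / 2 * r)" by (rule scale_id) simp
  have lo: "class_Kinf lo" unfolding lo_def
    by (rule class_Kinf_min[OF class_Kinf_comp[OF Q(1) class_Kinf_comp[OF alphas(1) half]]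
        class_Kinf_comp[OF P(1) class_Kinf_scale[OF class_Kinf_comp[OF class_Kinf_square half] pos(1)]]])
  have up: "class_Kinf up" unfolding up_def
    by (rule class_Kinf_add[OF class_Kinf_comp[OF Q(1) alphas(2)]
        class_Kinf_K[OF class_Kinf_comp[OF P(1) class_Kinf_scale[OF class_Kinf_square pos(2)]]]])
  have \<eta>: "class_Kinf \<eta>" unfolding \<eta>_def
    by (rule class_Kinf_comp[OF half class_Kinf_min[OF class_Kinf_scale[OF class_Kinf_comp[OF \<kappa> half] const_pos(3)] half]])
  have A\<eta>: "class_Kinf (\<lambda>r. A (\<eta> r))" and m\<eta>: "class_Kinf (\<lambda>r. m (\<eta> r))" and q\<eta>: "class_K (\<lambda>r. q (\<eta> r))"
    by (rule class_Kinf_comp[OF A \<eta>], rule class_Kinf_comp[OF m(1) \<eta>], rule class_K_comp[OF q class_Kinf_K[OF \<eta>]])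
  have thr: "class_Kinf thr" unfolding thr_def
    using const_pos pos by (intro class_Kinf_min class_Kinf_scale A\<eta> m\<eta>) auto
  have dec: "class_Kinf dec" unfolding dec_def
    by (intro class_Kinf_min class_Kinf_mult class_Kinf_scale A\<eta> m\<eta> q\<eta>
        class_Kinf_K[OF class_Kinf_mult[OF \<eta> q\<eta>]]) (use const_pos in auto)

  define U where "U = (\<lambda>t z. Q (V t (fst z)) + P (W t (snd z)))"
  have lin: "bounded_linear (\<lambda>y::real \<times> 'x \<times> 'p. (fst y, fst (snd y)))"
    "bounded_linear (\<lambda>y::real \<times> 'x \<times> 'p. (fst y, snd (snd y)))"
    by (intro bounded_linear_Pair bounded_linear_fst bounded_linear_snd
        bounded_linear_compose[OF bounded_linear_fst bounded_linear_snd]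
        bounded_linear_compose[OF bounded_linear_snd bounded_linear_snd])+
  have "C1_on (\<lambda>y::real \<times> 'x \<times> 'p. (\<lambda>(t, x). V t x) (fst y, fst (snd y))) ({0..} \<times> UNIV)"
    by (rule C1_on_compose_linear[OF V lin(1)]) auto
  moreover have "C1_on (\<lambda>y::real \<times> 'x \<times> 'p. (\<lambda>(t, x). W t x) (fst y, snd (snd y))) ({0..} \<times> UNIV)"
    by (rule C1_on_compose_linear[OF W lin(2)]) auto
  moreover have "continuous_on UNIV (\<lambda>v. p (max v 0))" if "class_K p" for p :: "real \<Rightarrow> real"
    by (rule continuous_on_compose2[OF class_K_D(1)[OF that]]) (auto intro!: continuous_intros)
  ultimately have "C1_on (\<lambda>y. Q (V (fst y) (fst (snd y))) + P (W (fst y) (snd (snd y)))) ({0..} \<times> UNIV)"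
    using p1 p2
    by (intro C1_on_add C1_on_compose_real[OF _ Q(2)] C1_on_compose_real[OF _ P(2)]) simp_all
  then have U: "C1_on (\<lambda>(t, z). U t z) ({0..} \<times> UNIV)" by (simp add: U_def case_prod_unfold)

  have VW0: "0 \<le> V t x" "0 \<le> W t p" if "0 \<le> t" for t x p
    using order_trans[OF class_Kinf_D(4)[OF alphas(1)] V_bounds(1)[OF that, of x]]
      order_trans[OF mult_nonneg_nonneg W_bounds(1)[OF that, of p]] pos by auto
  have split: "norm x \<ge> norm (x, p) / 2 \<or> norm p \<ge> norm (x, p) / 2" for x :: 'x and p :: 'p
    using norm_Pair_le[of x p] by linarith
  show ?thesis
  proof (rule uniformly_ISS_I[OF U lo up thr dec \<rho>])
    fix t :: real and z :: "'x \<times> 'p" assume t: "0 \<le> t"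
    obtain x p where z: "z = (x, p)" by (cases z)
    have QP0: "0 \<le> Q (V t x)" "0 \<le> P (W t p)"
      using class_Kinf_D(4)[OF Q(1)] class_Kinf_D(4)[OF P(1)] VW0[OF t] by auto
    show "lo (norm z) \<le> U t z"
      using split[of x p]
    proof
      assume "norm (x, p) / 2 \<le> norm x"
      then have "\<alpha>1 (1 / 2 * norm z) \<le> V t x"
        using V_bounds(1)[OF t, of x] class_Kinf_D(5)[OF alphas(1), of "1 / 2 * norm z" "norm x"] by (simp add: z)
      then have "Q (\<alpha>1 (1 / 2 * norm z)) \<le> Q (V t x)"
        using class_Kinf_D(4)[OF alphas(1)] by (intro class_Kinf_D(5)[OF Q(1)]) auto
      then show ?thesis using QP0 by (simp add: lo_def U_def z)
    next
      assume "norm (x, p) / 2 \<le> norm p"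
      then have "a1 * (1 / 2 * norm z)\<^sup>2 \<le> a1 * (norm p)\<^sup>2"
        using pos by (intro mult_left_mono power_mono) (auto simp: z)
      then have "P (a1 * (1 / 2 * norm z)\<^sup>2) \<le> P (W t p)"
        using order_trans[OF _ W_bounds(1)[OF t, of p]] pos by (intro class_Kinf_D(5)[OF P(1)]) simp_all
      then show ?thesis using QP0 by (simp add: lo_def U_def z)
    qed
    have le: "norm x \<le> norm z" "norm p \<le> norm z" by (auto simp: z norm_Pair)
    have "V t x \<le> \<alpha>2 (norm z)" using V_bounds(2)[OF t, of x] class_Kinf_D(5)[OF alphas(2) _ le(1)] by simp
    moreover have "W t p \<le> a2 * (norm z)\<^sup>2"
      by (rule order_trans[OF W_bounds(2)[OF t]]) (intro mult_left_mono power_mono le norm_ge_zero less_imp_le[OF pos(2)])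
    ultimately show "U t z \<le> up (norm z)"
      unfolding U_def up_def z fst_conv snd_conv
      using VW0[OF t] by (intro add_mono class_Kinf_D(5)[OF Q(1)] class_Kinf_D(5)[OF P(1)]) auto
  next
    fix t :: real and z :: "'x \<times> 'p" and d :: 'd
    assume t: "0 \<le> t" and d: "\<rho> (norm d) \<le> thr (norm z)"
    obtain x p where z: "z = (x, p)" by (cases z)
    define v where "v = V t x"
    define y where "y = sqrt (1 / a1 * W t p)"
    define D where "D = deriv_along V t x (fst (f t z d))"
    define E where "E = deriv_along W t p (snd (f t z d))"
    have v: "0 \<le> v" using VW0 t by (simp add: v_def)
    have Xv: "0 \<le> X v" using class_Kinf_D(4)[OF X v] .
    have rho0: "0 \<le> \<rho> (norm d)" using class_K_D(4)[OF \<rho>] by simp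
    have y0: "0 \<le> y" using VW0(2)[OF t, of p] pos by (simp add: y_def)
    have py: "norm p \<le> y"
      unfolding y_def using W_bounds(1)[OF t, of p] pos by (intro real_le_rsqrt) (simp add: field_simps)
    have yp: "b * y \<le> norm p"
    proof -
      have "b * y = sqrt (W t p / a2)"
        using pos by (simp add: b_def y_def real_sqrt_divide)
      also have "\<dots> \<le> norm p"
        using W_bounds(2)[OF t, of p] pos by (intro real_le_lsqrt) (auto simp: field_simps VW0 t)
      finally show ?thesis .
    qed
    have i1v: "norm x \<le> i1 v"
      using class_Kinf_D(5)[OF i1(3), of "\<alpha>1 (norm x)" v] V_bounds(1)[OF t, of x] i1(2)[of "norm x"]
        class_Kinf_D(4)[OF alphas(1), of "norm x"] by (simp add: v_def)
    have i2v: "i2 v \<le> norm x"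
      using class_Kinf_D(5)[OF i2(3) v, of "\<alpha>2 (norm x)"] V_bounds(2)[OF t, of x] i2(2)[of "norm x"]
      by (simp add: v_def)
    have AX: "A (X v) \<le> \<alpha>3 (norm x)"
      unfolding A_def RX[OF v] i1(1)[OF v]
      using i2v class_Kinf_D(4)[OF i2(3) v] by (intro class_Kinf_D(5)[OF alphas(3)]) auto
    have kX: "a * \<kappa> (norm x) \<le> X v"
      unfolding X_def using class_Kinf_D(5)[OF \<kappa> _ i1v] const_pos by simp
    \<comment> \<open>The small-gain condition is stated in the norm of \<open>x\<close>, so
      \<open>X v\<close> is first bounded through \<open>V \<le> \<alpha>2\<close>; the margin
      \<open>m\<close> then lets \<open>y\<close> exceed \<open>X v\<close> at the price of part of
      \<open>\<tau>\<close>.\<close>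
    have D1: "D \<le> - c * A (X v) + \<rho> (norm d)" if yX: "y \<le> X v + m (X v)"
    proof -
      have "X v \<le> a * \<kappa> (i1 (\<alpha>2 (norm x)))"
        using V_bounds(2)[OF t, of x] class_Kinf_D(5)[OF X v, of "\<alpha>2 (norm x)"] by (simp add: X_def v_def)
      note mono = class_K_D(5)[OF \<gamma>(1)]
      have "\<gamma> (norm p) \<le> \<gamma> (X v + m (X v))" using py yX by (intro mono) auto
      also have "\<dots> \<le> (1 + \<tau>) / 2 * \<gamma> (X v)" by (rule m(3)[OF Xv])
      also have "\<dots> \<le> (1 + \<tau>) / 2 * \<gamma> (a * \<kappa> (i1 (\<alpha>2 (norm x))))"
        using \<tau> mono[OF Xv] \<open>X v \<le> _\<close> by (intro mult_left_mono) auto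
      finally have "\<omega> (norm x) * \<gamma> (norm p) \<le> \<omega> (norm x) * ((1 + \<tau>) / 2 * \<gamma> (a * \<kappa> (i1 (\<alpha>2 (norm x)))))"
        using \<omega>D(3) by (intro mult_left_mono) auto
      also have "\<dots> = (1 + \<tau>) / 2 / \<tau> * (\<tau> * \<gamma> (a * \<kappa> (i1 (\<alpha>2 (norm x)))) * \<omega> (norm x))"
        using \<tau> by (simp add: field_simps)
      also have "\<dots> \<le> (1 + \<tau>) / 2 / \<tau> * \<alpha>3 (norm x)"
        using small_gain[of "norm x"] \<tau> unfolding a_eq i1_def[symmetric] by (intro mult_left_mono) auto
      finally have "D \<le> - c * \<alpha>3 (norm x) + \<rho> (norm d)"
        using V_decay[OF t, of x p d] by (simp add: D_def z c_def algebra_simps)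
      also have "- c * \<alpha>3 (norm x) \<le> - c * A (X v)" using AX const_pos by simp
      finally show ?thesis by simp
    qed
    \<comment> \<open>Without any relation between \<open>y\<close> and \<open>X v\<close>, only the
      bound \<open>\<gamma> \<le> l\<close> is available.\<close>
    have D2: "D \<le> B (X v) + \<rho> (norm d)"
    proof -
      have "\<omega> (norm x) * \<gamma> (norm p) \<le> \<omega> (i1 v) * l"
        using \<omega>D \<gamma>(2) class_K_D(4)[OF \<gamma>(1)] i1v class_Kinf_D(4)[OF i1(3) v] by (intro mult_mono) auto
      then show ?thesis
        using V_decay[OF t, of x p d] class_Kinf_D(4)[OF alphas(3), of "norm x"]
        by (simp add: D_def z B_def RX[OF v] mult.commute)
    qed
    have E: "E \<le> norm p * (g * (X v - y) + a4 * \<rho> (norm d))"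
    proof -
      have "E \<le> norm p * (- a3 * norm p + a4 * \<kappa> (norm x) + a4 * \<rho> (norm d))"
        using W_decay[OF t, of p x d] by (simp add: E_def z algebra_simps power2_eq_square)
      also have "\<dots> \<le> norm p * (- a3 * (b * y) + g * X v + a4 * \<rho> (norm d))"
      proof (rule mult_left_mono[OF _ norm_ge_zero], intro add_mono order_refl)
        show "- a3 * norm p \<le> - a3 * (b * y)" using yp pos by simp
        have "a4 * \<kappa> (norm x) = g * (a * \<kappa> (norm x))" using const_pos by (simp add: a_def)
        also have "\<dots> \<le> g * X v" using kX const_pos by simp
        finally show "a4 * \<kappa> (norm x) \<le> g * X v" .
      qed
      finally show ?thesis by (simp add: g_def algebra_simps)
    qed
    have \<eta>0: "0 \<le> 2 * \<eta> (norm z)" using class_Kinf_D(4)[OF \<eta>] by simp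
    have \<eta>max: "2 * \<eta> (norm z) \<le> max (X v) y"
      using split[of x p]
    proof
      assume "norm (x, p) / 2 \<le> norm x"
      then have "a * \<kappa> (1 / 2 * norm z) \<le> a * \<kappa> (norm x)"
        using const_pos by (intro mult_left_mono class_Kinf_D(5)[OF \<kappa>]) (auto simp: z)
      then show ?thesis using kX by (simp add: \<eta>_def)
    next
      assume "norm (x, p) / 2 \<le> norm p"
      then show ?thesis using py by (simp add: \<eta>_def z)
    qed
    have "deriv_along U t z (f t z d) = q (X v + 2 * m (X v) / 3) * D + q y * E"
      unfolding U_def deriv_along_sum_compose[OF V W Q(2) P(2) t]
      using VW0[OF t] by (simp add: z D_def E_def p1_def p2_def v_def y_def)
    also have "\<dots> \<le> - dec (norm z)"
      using composite_decay[OF q m(1,2) A const_pos(4) const_pos(2) pos(4) const_pos(1) growth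
          Xv y0 yp py rho0 D1 D2 E \<eta>0 \<eta>max] d
      by (simp add: thr_def dec_def)
    finally show "deriv_along U t z (f t z d) \<le> - dec (norm z)" .
  qed
qed

section \<open>The adaptive closed loop\<close>

lemma norm_matrix_vector_mult_le: "norm (A *v x) \<le> opnorm A * norm x"
  unfolding opnorm_def by (rule onorm[OF matrix_vector_mul_bounded_linear])

lemma opnorm_nonneg: "0 \<le> opnorm A"
  unfolding opnorm_def by (rule onorm_pos_le[OF matrix_vector_mul_bounded_linear])

lemma inner_matrix_vector_mult: "x \<bullet> (A *v y) = (x v* A) \<bullet> y"
  for A :: "real^'n^'m"
  by (simp add: dot_lmul_matrix)

lemma satv_ident:
  assumes "norm v \<le> ls"
  shows "satv ls eps v = v"
  using component_le_norm_cart[of v] assms order_trans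
  by (fastforce simp: satv_def sat_def vec_eq_iff)

lemma abs_sat_le:
  assumes "0 \<le> ls" "0 < eps"
  shows "\<bar>sat ls eps s\<bar> \<le> ls + eps / 2"
proof -
  consider "\<bar>s\<bar> \<le> ls" | "ls < \<bar>s\<bar>" "\<bar>s\<bar> \<le> ls + eps" | "ls + eps < \<bar>s\<bar>" by linarith
  then show ?thesis
  proof cases
    case 2
    define u where "u = \<bar>s\<bar> - ls"
    have u: "0 < u" "u \<le> eps" using 2 by (auto simp: u_def)
    have "u\<^sup>2 / (2 * eps) \<le> u"
      using u assms mult_right_mono[of u "2 * eps" u] by (simp add: field_simps power2_eq_square)
    moreover have "u - u\<^sup>2 / (2 * eps) \<le> eps / 2"
    proof -
      \<comment> \<open>On the quadratic branch this square is exactly the slack below the final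
        level \<open>ls + eps / 2\<close>, reached at \<open>u = eps\<close>.\<close>
      have "0 \<le> (eps - u)\<^sup>2 / (2 * eps)" using assms by simp
      also have "\<dots> = eps / 2 - (u - u\<^sup>2 / (2 * eps))"
        using assms by (simp add: field_simps power2_eq_square)
      finally show ?thesis by simp
    qed
    moreover have "sat ls eps s = sgn s * (\<bar>s\<bar> - u\<^sup>2 / (2 * eps))"
      using 2 by (simp add: sat_def u_def right_diff_distrib sgn_mult_abs)
    then have "\<bar>sat ls eps s\<bar> = \<bar>\<bar>s\<bar> - u\<^sup>2 / (2 * eps)\<bar>"
      using 2 assms by (auto simp: abs_mult abs_sgn_eq)
    ultimately show ?thesis using assms by (simp add: u_def abs_le_iff)
  qed (use assms in \<open>auto simp: sat_def abs_mult abs_sgn_eq\<close>)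
qed

lemma satv_in_sat_box:
  assumes "0 \<le> ls" "0 < eps"
  shows "satv ls eps v \<in> sat_box ls eps"
  using abs_sat_le[OF assms] by (simp add: sat_box_def satv_def)

text \<open>The mean value inequality is applied along the segment between two saturated vectors, so
  the derivative bound must hold on a convex set containing both.\<close>

lemma convex_sat_box: "convex (sat_box ls eps :: (real^'q) set)"
proof -
  have "\<bar>x\<bar> \<le> c \<longleftrightarrow> - c \<le> x \<and> x \<le> c" for x c :: real by arith
  then have "(sat_box ls eps :: (real^'q) set) = cbox (\<chi> i. - (ls + eps / 2)) (\<chi> i. ls + eps / 2)"
    by (simp add: set_eq_iff sat_box_def mem_box_cart)
  then show ?thesis by (simp only: convex_box)
qed

lemma C1_on_UNIV_lipschitz:
  assumes "C1_on f UNIV" "convex S" "\<And>p. p \<in> S \<Longrightarrow> onorm (frechet_derivative f (at p)) \<le> B"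
    and "p \<in> S" "p' \<in> S"
  shows "norm (f p - f p') \<le> B * norm (p - p')"
proof (rule differentiable_bound[OF assms(2) _ assms(3-5)])
  show "(f has_derivative frechet_derivative f (at p)) (at p within S)" for p
    using assms(1) unfolding C1_on_def
    by (metis UNIV_I differentiableI frechet_derivative_works has_derivative_at_withinI)
qed

lemma deriv_along_add: "deriv_along V t z (v + w) = deriv_along V t z v + grad (V t) z \<bullet> w"
  by (simp add: deriv_along_def inner_add_right)

text \<open>Completing the square at \<open>d = 2 * k * w\<close>. The damping thus removes the
  gradient from the input term, however large that gradient is.\<close>

lemma damped_inner_le:
  fixes w d :: "'a::real_inner"
  assumes "0 < k"
  shows "w \<bullet> d - k * (w \<bullet> w) \<le> (norm d)\<^sup>2 / (4 * k)"
proof -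
  have "0 \<le> (norm (d - (2 * k) *\<^sub>R w))\<^sup>2 / (4 * k)" using assms by simp
  also have "\<dots> = (norm d)\<^sup>2 / (4 * k) - (w \<bullet> d - k * (w \<bullet> w))"
    using assms unfolding power2_norm_eq_inner
    by (simp add: inner_diff_left inner_diff_right inner_commute field_simps)
  finally show ?thesis by simp
qed

theorem theorem3:
  fixes f1 :: "real^'n \<Rightarrow> real^'n"
    and \<phi> :: "real^'q \<Rightarrow> real^'n \<Rightarrow> real^'n"
    and g1 :: "real^'n \<Rightarrow> real^'m^'n"
    and \<psi> :: "real^'n \<Rightarrow> real^'n \<Rightarrow> real^'q \<Rightarrow> real^'n \<Rightarrow> real^'m"
    and vsig :: "real^'n \<Rightarrow> real^'n^'q"
    and M1 :: "real^'n \<Rightarrow> real^'q^'q"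
    and xr :: "real \<Rightarrow> real^'n"
    and Theta :: "(real^'q) set"
    and \<theta> :: "real^'q"
    and Verr :: "real \<Rightarrow> real^'n \<Rightarrow> real"
    and Vest :: "real \<Rightarrow> real^'q \<Rightarrow> real"
    and \<alpha>1 \<alpha>2 \<alpha>3 \<alpha>4 \<gamma>s \<kappa>1 \<kappa>2 \<kappa>3 \<kappa>4 \<kappa>bar :: "real \<Rightarrow> real"
    and l\<theta> ls eps r1 \<delta> \<mu> l\<gamma> kdz a1 a2 a3 a4 a \<tau> kd :: real
  assumes Theta: "compact Theta" "\<theta> \<in> Theta"
    and levels: "\<forall>p\<in>Theta. norm p \<le> l\<theta>" "l\<theta> < ls" "0 < eps" "eps \<le> 1"
    \<comment> \<open>regressor and reference\<close>
    and phi_C1: "\<forall>x. C1_on (\<lambda>p. \<phi> p x) UNIV"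
    and reference: "C1_on xr {0..}" "0 < r1" "\<forall>t\<ge>0. xr t \<in> cball 0 r1"
    \<comment> \<open>monotonicity and persistent excitation\<close>
    and ls_sqrt: "sqrt (real CARD('q)) * l\<theta> < ls"
    and sigma_cont: "continuous_on UNIV vsig"
    and M1_cont: "continuous_on UNIV M1"
    and monotonicity: "\<forall>t\<ge>0. \<forall>p\<in>Theta. \<forall>p'. norm p' \<le> ls \<longrightarrow>
           (p' - p) \<bullet> (vsig (xr t) *v (\<phi> p' (xr t) - \<phi> p (xr t)))
             \<ge> (p' - p) \<bullet> (M1 (xr t) *v (p' - p))
         \<and> (p' - p) \<bullet> (M1 (xr t) *v (p' - p)) \<ge> 0"
    and excitation: "0 < \<delta>" "0 < \<mu>"
         "\<forall>t\<ge>0. loewner_le (mat \<mu>)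
            (integral {t..t+\<delta>} (\<lambda>s. M1 (xr s) + transpose (M1 (xr s))))"
    and beta_deriv: "\<forall>y e. ((\<lambda>e. beta vsig e y) has_derivative (\<lambda>h. vsig (e + y) *v h)) (at e)"
    \<comment> \<open>stabilisability of the error dynamics for known parameter\<close>
    and Verr_C1: "C1_on (\<lambda>(t, e). Verr t e) ({0..} \<times> UNIV)"
    and alphas: "class_Kinf \<alpha>1" "class_Kinf \<alpha>2" "class_Kinf \<alpha>3" "class_Kinf \<alpha>4"
    and equilibrium: "\<forall>t\<ge>0. \<forall>p. errF f1 \<phi> g1 \<psi> (xr t) (dtime xr t) p 0 = 0"
    and Verr_bounds: "\<forall>t\<ge>0. \<forall>e. \<alpha>1 (norm e) \<le> Verr t e \<and> Verr t e \<le> \<alpha>2 (norm e)"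
    and Verr_decay: "\<forall>t\<ge>0. \<forall>p e.
           deriv_along Verr t e (errF f1 \<phi> g1 \<psi> (xr t) (dtime xr t) p e) \<le> - \<alpha>3 (norm e)"
    and Verr_grad: "\<forall>t\<ge>0. \<forall>e. norm (grad (Verr t) e) \<le> \<alpha>4 (norm e)"
    \<comment> \<open>bounding functions\<close>
    and gamma_s: "class_K \<gamma>s" "\<not> class_Kinf \<gamma>s" "0 < l\<gamma>"
         "\<forall>s\<ge>0. \<gamma>s s \<le> l\<gamma> \<and> \<gamma>s s \<le> s"
         "\<forall>p\<in>Theta. \<forall>\<theta>t. norm (satv ls eps (p + \<theta>t) - p) \<le> \<gamma>s (norm \<theta>t)"
    and kappa1: "class_SN \<kappa>1"
         "\<forall>s\<ge>0. \<forall>p\<in>sat_box ls eps. \<forall>y\<in>cball 0 r1. \<forall>e\<in>cball 0 s.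
            onorm (frechet_derivative (\<lambda>p. \<phi> p (e + y)) (at p)) \<le> \<kappa>1 s"
    and kappa2: "class_K \<kappa>2"
         "\<forall>y\<in>cball 0 r1. \<forall>e. \<forall>p1\<in>sat_box ls eps. \<forall>p2\<in>sat_box ls eps.
            norm (varphi \<phi> vsig p1 y (e + y) - varphi \<phi> vsig p2 y (e + y))
              \<le> \<kappa>2 (norm e) * norm (p1 - p2)"
    and kappa3: "class_K \<kappa>3"
         "\<forall>e. \<forall>y\<in>cball 0 r1. opnorm (g1 (e + y)) \<le> \<kappa>3 (norm e) + sup_opnorm g1 r1"
    and kappa4: "class_K \<kappa>4"
         "\<forall>e. \<forall>y\<in>cball 0 r1. opnorm (vsig (e + y)) \<le> \<kappa>4 (norm e) + sup_opnorm vsig r1"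
    and kappa_bar: "\<kappa>bar = kappa2_bar l\<gamma> \<kappa>2 \<kappa>3 \<kappa>4 (sup_opnorm g1 r1) (sup_opnorm vsig r1)"
         "class_Kinf \<kappa>bar"
    \<comment> \<open>design gain and estimator Lyapunov function\<close>
    and est_consts: "0 < kdz" "0 < a1" "0 < a2" "0 < a3" "0 < a4"
    and Vest_C1: "C1_on (\<lambda>(t, \<theta>t). Vest t \<theta>t) ({0..} \<times> UNIV)"
    and Vest_bounds: "\<forall>t\<ge>0. \<forall>\<theta>t. a1 * (norm \<theta>t)\<^sup>2 \<le> Vest t \<theta>t \<and> Vest t \<theta>t \<le> a2 * (norm \<theta>t)\<^sup>2"
    and Vest_decay: "\<forall>t\<ge>0. \<forall>\<theta>t.
           deriv_along Vest t \<theta>t (H_est \<phi> vsig ls eps l\<theta> kdz \<theta> \<theta>t (xr t)) \<le> - a3 * (norm \<theta>t)\<^sup>2"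
    and Vest_grad: "\<forall>t\<ge>0. \<forall>\<theta>t. norm (grad (Vest t) \<theta>t) \<le> a4 * norm \<theta>t"
    and a_star: "a = sqrt a2 * a4 / (sqrt a1 * a3)"
    \<comment> \<open>small-gain condition\<close>
    and small_gain: "1 < \<tau>"
         "\<forall>s\<ge>0. \<alpha>3 s \<ge> \<tau> * \<gamma>s (a * \<kappa>bar (inv_into {0..} \<alpha>1 (\<alpha>2 s))) * \<alpha>4 s * \<kappa>1 s"
    and damping_gain: "0 < kd"
  shows "uniformly_ISS (error_system f1 \<phi> g1 \<psi> vsig ls eps l\<theta> kdz kd Verr xr \<theta>)
       \<and> uniformly_ISS (closed_loop_error f1 \<phi> g1 \<psi> vsig ls eps l\<theta> kdz kd Verr xr \<theta>)"
proof -
  define c3 where "c3 = sup_opnorm g1 r1"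
  define c4 where "c4 = sup_opnorm vsig r1"
  note xr_in = reference(3)[rule_format]
  have l0: "norm \<theta> \<le> l\<theta>" using levels(1) Theta(2) by blast
  then have ls0: "0 \<le> ls" using levels(2) norm_ge_zero[of \<theta>] by linarith
  have sat_\<theta>: "satv ls eps \<theta> = \<theta>" using l0 levels(2) by (intro satv_ident) simp
  note in_box = satv_in_sat_box[OF ls0 levels(3)]
  have sat_err: "norm (satv ls eps (\<theta> + p) - \<theta>) \<le> \<gamma>s (norm p)" for p
    using gamma_s(5) Theta(2) by blast
  \<comment> \<open>Evaluating the growth bounds at the origin, where \<open>\<kappa>3\<close> and
    \<open>\<kappa>4\<close> vanish, compares the suprema with operator norms directly.\<close>
  have c_nonneg: "0 \<le> c3" "0 \<le> c4"
  proof -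
    have "0 \<in> cball (0::real^'n) r1" using reference(2) by simp
    then have "opnorm (g1 (0 + 0)) \<le> \<kappa>3 (norm (0::real^'n)) + c3" "opnorm (vsig (0 + 0)) \<le> \<kappa>4 (norm (0::real^'n)) + c4"
      using kappa3(2) kappa4(2) unfolding c3_def c4_def by blast+
    then show "0 \<le> c3" "0 \<le> c4"
      using opnorm_nonneg[of "g1 0"] opnorm_nonneg[of "vsig 0"] class_K_D(3)[OF kappa3(1)] class_K_D(3)[OF kappa4(1)]
      by auto
  qed
  define \<omega> where "\<omega> = (\<lambda>s. \<alpha>4 s * \<kappa>1 s)"
  have k1: "continuous_on {0..} \<kappa>1" "mono_on {0..} \<kappa>1" "\<And>s. 0 \<le> s \<Longrightarrow> 0 \<le> \<kappa>1 s"
    using kappa1(1) by (auto simp: class_SN_def)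
  have \<omega>: "class_SN \<omega>"
    unfolding class_SN_def \<omega>_def
    by (intro conjI allI impI mono_onI continuous_intros mult_mono mult_nonneg_nonneg
        class_Kinf_D(1,4,5)[OF alphas(4)] k1 mono_onD[OF k1(2)]) auto
  \<comment> \<open>One gain for both equations: \<open>1 / (4 * kd)\<close> comes from the damped
    input, the other quadratic part from splitting a product below, and \<open>c3 * c4\<close> from
    the input gain at zero error. The last added 1 keeps the linear coefficient positive.\<close>
  define \<rho> where "\<rho> = (\<lambda>r. (1 / (4 * kd) + 1) * r\<^sup>2 + (c3 * c4 + 1) * r)"
  have \<rho>: "class_K \<rho>"
    unfolding \<rho>_def using damping_gain c_nonneg
    by (intro class_K_add class_K_scale class_Kinf_K[OF class_Kinf_square] class_Kinf_K[OF class_Kinf_id])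
       (auto intro!: add_nonneg_pos)
  have \<rho>_ge: "r\<^sup>2 / (4 * kd) \<le> \<rho> r" "r\<^sup>2 + c3 * c4 * r \<le> \<rho> r" if "0 \<le> r" for r
    using that damping_gain c_nonneg by (auto simp: \<rho>_def algebra_simps add_nonneg_nonneg)

  have phi_bound: "norm (phi_s \<phi> ls eps \<theta> p (e + xr t)) \<le> \<kappa>1 (norm e) * \<gamma>s (norm p)" if t: "0 \<le> t" for t e p
  proof -
    have "norm (phi_s \<phi> ls eps \<theta> p (e + xr t))
        \<le> \<kappa>1 (norm e) * norm (satv ls eps (\<theta> + p) - satv ls eps \<theta>)"
      unfolding phi_s_def
    proof (rule C1_on_UNIV_lipschitz[OF _ convex_sat_box _ in_box in_box])
      show "C1_on (\<lambda>p. \<phi> p (e + xr t)) UNIV" using phi_C1 by blast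
      show "onorm (frechet_derivative (\<lambda>p. \<phi> p (e + xr t)) (at p)) \<le> \<kappa>1 (norm e)"
        if "p \<in> sat_box ls eps" for p
        using kappa1(2)[rule_format, of "norm e" p "xr t" e] that xr_in[OF t] by simp
    qed
    also have "\<dots> \<le> \<kappa>1 (norm e) * \<gamma>s (norm p)"
      using sat_err[of p] k1(3)[of "norm e"] by (intro mult_left_mono) (auto simp: sat_\<theta>)
    finally show ?thesis .
  qed
  have delta_bound: "norm (Delta_est \<phi> vsig ls eps \<theta> p (xr t) e) \<le> \<kappa>2 (norm e) * \<gamma>s (norm p)"
    if t: "0 \<le> t" for t e p
  proof -
    have "norm (Delta_est \<phi> vsig ls eps \<theta> p (xr t) e) \<le> \<kappa>2 (norm e) * norm (satv ls eps \<theta> - satv ls eps (\<theta> + p))"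
      unfolding Delta_est_def using kappa2(2) xr_in[OF t] in_box by blast
    also have "\<dots> \<le> \<kappa>2 (norm e) * \<gamma>s (norm p)"
      using sat_err[of p] class_K_D(4)[OF kappa2(1), of "norm e"]
      by (intro mult_left_mono) (auto simp: sat_\<theta> norm_minus_commute)
    finally show ?thesis .
  qed
  have input_bound: "norm (vsig (e + xr t) *v (g1 (e + xr t) *v d)) \<le> nu \<kappa>3 \<kappa>4 c3 c4 (norm e) + \<rho> (norm d)"
    if t: "0 \<le> t" for t e and d :: "real^'m"
  proof -
    define k where "k = \<kappa>3 (norm e) * \<kappa>4 (norm e) + c4 * \<kappa>3 (norm e) + c3 * \<kappa>4 (norm e)"
    have "norm (vsig (e + xr t) *v (g1 (e + xr t) *v d))
        \<le> opnorm (vsig (e + xr t)) * (opnorm (g1 (e + xr t)) * norm d)"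
      by (rule order_trans[OF norm_matrix_vector_mult_le mult_left_mono[OF norm_matrix_vector_mult_le opnorm_nonneg]])
    also have "\<dots> \<le> (\<kappa>4 (norm e) + c4) * ((\<kappa>3 (norm e) + c3) * norm d)"
    proof (intro mult_mono order_refl mult_nonneg_nonneg opnorm_nonneg norm_ge_zero add_nonneg_nonneg c_nonneg
        class_K_D(4)[OF kappa3(1)] class_K_D(4)[OF kappa4(1)])
      show "opnorm (vsig (e + xr t)) \<le> \<kappa>4 (norm e) + c4" "opnorm (g1 (e + xr t)) \<le> \<kappa>3 (norm e) + c3"
        using kappa3(2) kappa4(2) xr_in[OF t] unfolding c3_def c4_def by blast+
    qed
    also have "\<dots> = k * norm d + c3 * c4 * norm d" by (simp add: k_def algebra_simps)
    \<comment> \<open>Splitting the product of state and input leaves the state part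
      \<open>k\<^sup>2\<close>, which is \<open>nu\<close>. This is the origin of the square there
      and lets that part be counted in \<open>\<kappa>bar\<close>.\<close>
    also have "k * norm d \<le> k\<^sup>2 + (norm d)\<^sup>2"
    proof -
      have "0 \<le> (k - norm d)\<^sup>2 + (k\<^sup>2 + (norm d)\<^sup>2)" by simp
      then show ?thesis by (simp add: power2_eq_square algebra_simps)
    qed
    finally show ?thesis using \<rho>_ge(2)[of "norm d"] by (simp add: nu_def k_def)
  qed

  \<comment> \<open>Stated for any vector field whose perturbation \<open>N\<close> is merely
    bounded in norm, so that both signs of \<open>Delta_est\<close> are covered and the two
    conclusions follow from one argument.\<close>
  have ISS: "uniformly_ISS f"
    if f_err: "\<And>t e p d. 0 \<le> t \<Longrightarrow> fst (f t (e, p) d) =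
          errF f1 \<phi> g1 \<psi> (xr t) (dtime xr t) (satv ls eps (\<theta> + p)) e
          - g1 (e + xr t) *v damping g1 kd Verr t (xr t) e
          - phi_s \<phi> ls eps \<theta> p (e + xr t) + g1 (e + xr t) *v d"
      and f_est: "\<And>t e p d. 0 \<le> t \<Longrightarrow> \<exists>N. snd (f t (e, p) d) =
          H_est \<phi> vsig ls eps l\<theta> kdz \<theta> p (xr t) + N + vsig (e + xr t) *v (g1 (e + xr t) *v d)
          \<and> norm N \<le> \<kappa>2 (norm e) * \<gamma>s (norm p)"
    for f :: "real \<Rightarrow> (real^'n) \<times> (real^'q) \<Rightarrow> real^'m \<Rightarrow> (real^'n) \<times> (real^'q)"
  proof (rule small_gain_ISS[OF Verr_C1 Vest_C1 alphas(1-3) _ _ est_consts(2-5) _ _ gamma_s(1) _ _ \<omega> kappa_bar(2) \<rho> _ _ small_gain(1)])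
    fix t :: real and e :: "real^'n" and p :: "real^'q" and d :: "real^'m"
    assume t: "0 \<le> t"
    define r where "r = grad (Verr t) e"
    define G where "G = g1 (e + xr t)"
    have "deriv_along Verr t e (fst (f t (e, p) d)) =
        deriv_along Verr t e (errF f1 \<phi> g1 \<psi> (xr t) (dtime xr t) (satv ls eps (\<theta> + p)) e)
        + r \<bullet> (G *v d - G *v damping g1 kd Verr t (xr t) e - phi_s \<phi> ls eps \<theta> p (e + xr t))"
      unfolding f_err[OF t] r_def G_def deriv_along_add[symmetric] by (simp add: algebra_simps)
    also have "\<dots> \<le> - \<alpha>3 (norm e) + ((norm d)\<^sup>2 / (4 * kd) + \<omega> (norm e) * \<gamma>s (norm p))"
    proof (rule add_mono)
      show "deriv_along Verr t e (errF f1 \<phi> g1 \<psi> (xr t) (dtime xr t) (satv ls eps (\<theta> + p)) e) \<le> - \<alpha>3 (norm e)"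
        using Verr_decay t by blast
      \<comment> \<open>Moving \<open>G\<close> to the other factor turns the damping term into
        \<open>kd\<close> times the squared norm of \<open>r v* G\<close>.\<close>
      have "r \<bullet> (G *v d) - r \<bullet> (G *v damping g1 kd Verr t (xr t) e) \<le> (norm d)\<^sup>2 / (4 * kd)"
        using damped_inner_le[OF damping_gain, of "r v* G" d]
        by (simp only: inner_matrix_vector_mult damping_def r_def[symmetric] G_def[symmetric] inner_scaleR_right)
      moreover have "- (r \<bullet> phi_s \<phi> ls eps \<theta> p (e + xr t)) \<le> \<omega> (norm e) * \<gamma>s (norm p)"
      proof -
        have "- (r \<bullet> phi_s \<phi> ls eps \<theta> p (e + xr t)) \<le> norm r * norm (phi_s \<phi> ls eps \<theta> p (e + xr t))"
          using Cauchy_Schwarz_ineq2[of r "phi_s \<phi> ls eps \<theta> p (e + xr t)"] by linarith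
        also have "\<dots> \<le> \<alpha>4 (norm e) * (\<kappa>1 (norm e) * \<gamma>s (norm p))"
          unfolding r_def using Verr_grad t phi_bound[OF t] class_Kinf_D(4)[OF alphas(4), of "norm e"]
          by (intro mult_mono) auto
        finally show ?thesis by (simp add: \<omega>_def mult.assoc)
      qed
      ultimately show "r \<bullet> (G *v d - G *v damping g1 kd Verr t (xr t) e - phi_s \<phi> ls eps \<theta> p (e + xr t))
          \<le> (norm d)\<^sup>2 / (4 * kd) + \<omega> (norm e) * \<gamma>s (norm p)"
        by (simp add: inner_diff_right)
    qed
    finally show "deriv_along Verr t e (fst (f t (e, p) d))
        \<le> - \<alpha>3 (norm e) + \<omega> (norm e) * \<gamma>s (norm p) + \<rho> (norm d)"
      using \<rho>_ge(1)[of "norm d"] by simp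
    obtain N where N: "snd (f t (e, p) d) =
        H_est \<phi> vsig ls eps l\<theta> kdz \<theta> p (xr t) + N + vsig (e + xr t) *v (g1 (e + xr t) *v d)"
      "norm N \<le> \<kappa>2 (norm e) * \<gamma>s (norm p)"
      using f_est[OF t] by blast
    define M where "M = N + vsig (e + xr t) *v (g1 (e + xr t) *v d)"
    have "norm M \<le> \<kappa>2 (norm e) * \<gamma>s (norm p) + (nu \<kappa>3 \<kappa>4 c3 c4 (norm e) + \<rho> (norm d))"
      unfolding M_def by (rule norm_triangle_le[OF add_mono[OF N(2) input_bound[OF t]]])
    \<comment> \<open>Bounding \<open>\<gamma>s\<close> by its ceiling makes the interconnection
      depend on the error only; together with \<open>nu\<close> it is precisely
      \<open>\<kappa>bar\<close>.\<close>
    also have "\<kappa>2 (norm e) * \<gamma>s (norm p) \<le> \<kappa>2 (norm e) * l\<gamma>"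
      using gamma_s(4) class_K_D(4)[OF kappa2(1), of "norm e"] by (intro mult_left_mono) auto
    finally have M: "norm M \<le> \<kappa>bar (norm e) + \<rho> (norm d)"
      by (simp add: kappa_bar(1) kappa2_bar_def c3_def c4_def mult.commute)
    have "grad (Vest t) p \<bullet> M \<le> (a4 * norm p) * (\<kappa>bar (norm e) + \<rho> (norm d))"
    proof -
      have "grad (Vest t) p \<bullet> M \<le> norm (grad (Vest t) p) * norm M" by (rule norm_cauchy_schwarz)
      also have "\<dots> \<le> (a4 * norm p) * (\<kappa>bar (norm e) + \<rho> (norm d))"
        using M Vest_grad t est_consts(5) by (intro mult_mono) auto
      finally show ?thesis .
    qed
    moreover have "deriv_along Vest t p (snd (f t (e, p) d))
        = deriv_along Vest t p (H_est \<phi> vsig ls eps l\<theta> kdz \<theta> p (xr t)) + grad (Vest t) p \<bullet> M"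
      unfolding N(1) M_def deriv_along_add[symmetric] by (simp add: add.assoc)
    ultimately show "deriv_along Vest t p (snd (f t (e, p) d))
        \<le> - a3 * (norm p)\<^sup>2 + a4 * norm p * (\<kappa>bar (norm e) + \<rho> (norm d))"
      using Vest_decay[rule_format, OF t, of p] by simp
  next
    show "\<tau> * \<gamma>s (sqrt a2 * a4 / (sqrt a1 * a3) * \<kappa>bar (inv_into {0..} \<alpha>1 (\<alpha>2 s))) * \<omega> s \<le> \<alpha>3 s"
      if "0 \<le> s" for s
      using small_gain(2)[rule_format, OF that] by (simp add: \<omega>_def a_star mult.assoc)
  qed (use Verr_bounds Vest_bounds gamma_s(3,4) in auto)

  have "uniformly_ISS (error_system f1 \<phi> g1 \<psi> vsig ls eps l\<theta> kdz kd Verr xr \<theta>)"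
    by (rule ISS) (use delta_bound in \<open>auto simp: error_system_def Let_def\<close>)
  moreover have "uniformly_ISS (closed_loop_error f1 \<phi> g1 \<psi> vsig ls eps l\<theta> kdz kd Verr xr \<theta>)"
  proof (rule ISS)
    fix t :: real and e :: "real^'n" and p :: "real^'q" and d :: "real^'m"
    assume t: "0 \<le> t"
    show "fst (closed_loop_error f1 \<phi> g1 \<psi> vsig ls eps l\<theta> kdz kd Verr xr \<theta> t (e, p) d) =
        errF f1 \<phi> g1 \<psi> (xr t) (dtime xr t) (satv ls eps (\<theta> + p)) e
        - g1 (e + xr t) *v damping g1 kd Verr t (xr t) e
        - phi_s \<phi> ls eps \<theta> p (e + xr t) + g1 (e + xr t) *v d"
      by (simp add: closed_loop_error_def Let_def plant_def errF_def phi_s_def sat_\<theta> add.commute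
          algebra_simps)
    have beta_fd: "frechet_derivative (\<lambda>e. beta vsig e (xr t)) (at e) = (\<lambda>h. vsig (e + xr t) *v h)"
      using frechet_derivative_at[OF beta_deriv[rule_format, of "xr t" e]] by simp
    define x where "x = e + xr t"
    define u where "u = \<psi> (xr t) (dtime xr t) (satv ls eps (\<theta> + p)) e - damping g1 kd Verr t (xr t) e"
    define w where "w = f1 x + \<phi> (satv ls eps (\<theta> + p)) x + g1 x *v u - dtime xr t"
    define b where "b = frechet_derivative (\<lambda>y. beta vsig e y) (at (xr t)) (dtime xr t)"
    have "plant f1 \<phi> g1 \<theta> x u d - dtime xr t = w - phi_s \<phi> ls eps \<theta> p x + g1 x *v d"
      by (simp add: plant_def w_def phi_s_def sat_\<theta> matrix_vector_right_distrib)
    \<comment> \<open>The estimator is built so that the known part \<open>w\<close> of the error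
      velocity and the reference term \<open>b\<close> cancel against the derivative of
      \<open>beta\<close>; the parameter mismatch, the dead zone and the input remain.\<close>
    then have "snd (closed_loop_error f1 \<phi> g1 \<psi> vsig ls eps l\<theta> kdz kd Verr xr \<theta> t (e, p) d) =
        - (vsig x *v w) - b - kdz *\<^sub>R dzv l\<theta> (p + \<theta>)
        + vsig x *v (w - phi_s \<phi> ls eps \<theta> p x + g1 x *v d) + b"
      by (simp add: closed_loop_error_def Let_def estimator_def beta_fd add.commute[of p \<theta>]
          x_def[symmetric] u_def[symmetric] w_def[symmetric] b_def[symmetric])
    also have "\<dots> = - (vsig x *v phi_s \<phi> ls eps \<theta> p x) - kdz *\<^sub>R dzv l\<theta> (p + \<theta>) + vsig x *v (g1 x *v d)"
      by (simp add: matrix_vector_right_distrib matrix_vector_mult_diff_distrib)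
    \<comment> \<open>Splitting the mismatch into its value at the reference and the rest. As the
      mismatch enters negatively, so does \<open>Delta_est\<close>.\<close>
    also have "vsig x *v phi_s \<phi> ls eps \<theta> p x
        = vsig (xr t) *v phi_s \<phi> ls eps \<theta> p (xr t) + Delta_est \<phi> vsig ls eps \<theta> p (xr t) e"
      by (simp add: Delta_est_def varphi_def phi_s_def sat_\<theta> x_def matrix_vector_mult_diff_distrib)
    finally have "snd (closed_loop_error f1 \<phi> g1 \<psi> vsig ls eps l\<theta> kdz kd Verr xr \<theta> t (e, p) d) =
        H_est \<phi> vsig ls eps l\<theta> kdz \<theta> p (xr t) + (- Delta_est \<phi> vsig ls eps \<theta> p (xr t) e)
        + vsig (e + xr t) *v (g1 (e + xr t) *v d)"
      by (simp add: H_est_def x_def)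
    then show "\<exists>N. snd (closed_loop_error f1 \<phi> g1 \<psi> vsig ls eps l\<theta> kdz kd Verr xr \<theta> t (e, p) d) =
        H_est \<phi> vsig ls eps l\<theta> kdz \<theta> p (xr t) + N + vsig (e + xr t) *v (g1 (e + xr t) *v d)
        \<and> norm N \<le> \<kappa>2 (norm e) * \<gamma>s (norm p)"
      using delta_bound[OF t] by (intro exI[of _ "- Delta_est \<phi> vsig ls eps \<theta> p (xr t) e"]) simp
  qed
  ultimately show ?thesis ..
qed

end
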